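(* Let $T$ be a triangle with angles $\alpha$, $2\alpha$ and $\pi-3\alpha$, where $0<\alpha<\pi/4$. (i) If $\cos^2\alpha$ is rational, then $T$ admits a 2-splitting gentiling. (ii) If $\cos\alpha$ is rational, then $T$ admits a 2-splitting reptiling.
   Context: An $r$-gentiling of a triangle $T$ ($r\ge 2$) is a subdivision of $T$ into $r$ triangles (tiles) with pairwise disjoint interiors, each similar to $T$; it is an $r$-reptiling if all tiles are moreover mutually congruent. For $k\ge2$, a $k$-splitting gentiling (resp. reptiling) of $T$ is a gentiling (resp. reptiling) in which exactly $k$ tiles meet at one of the vertices of $T$. *)

theory Defs
  imports "HOL-Analysis.Analysis"
begin

type_synonym point = "real^2"

text \<open>The unoriented angle at the vertex \<open>b\<close>, in \<open>[0, pi]\<close>; only meaningful if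
  \<open>a \<noteq> b\<close> and \<open>c \<noteq> b\<close>.\<close>

definition angle :: "point \<Rightarrow> point \<Rightarrow> point \<Rightarrow> real" where
  "angle a b c = arccos (((a - b) \<bullet> (c - b)) / (norm (a - b) * norm (c - b)))"

text \<open>Similarities and congruences may reverse orientation.\<close>

definition similarity_with_ratio :: "real \<Rightarrow> (point \<Rightarrow> point) \<Rightarrow> bool" where
  "similarity_with_ratio c f \<longleftrightarrow> c > 0 \<and> (\<forall>x y. dist (f x) (f y) = c * dist x y)"

definition similar :: "point set \<Rightarrow> point set \<Rightarrow> bool" where
  "similar S S' \<longleftrightarrow> (\<exists>c f. similarity_with_ratio c f \<and> f ` S = S')"

definition congruent_sets :: "point set \<Rightarrow> point set \<Rightarrow> bool" where
  "congruent_sets S S' \<longleftrightarrow> (\<exists>f. similarity_with_ratio 1 f \<and> f ` S = S')"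

text \<open>Triangles are closed and non-degenerate, i.e. 2-simplices, and tilings need not be
  edge-to-edge.\<close>

definition gentiling :: "nat \<Rightarrow> point set \<Rightarrow> point set set \<Rightarrow> bool" where
  "gentiling r T \<D> \<longleftrightarrow>
     r \<ge> 2 \<and> 2 simplex T \<and> finite \<D> \<and> card \<D> = r \<and> \<Union>\<D> = T \<and>
     (\<forall>D\<in>\<D>. 2 simplex D \<and> similar D T) \<and>
     (\<forall>D\<in>\<D>. \<forall>D'\<in>\<D>. D \<noteq> D' \<longrightarrow> interior D \<inter> interior D' = {})"

definition reptiling :: "nat \<Rightarrow> point set \<Rightarrow> point set set \<Rightarrow> bool" where
  "reptiling r T \<D> \<longleftrightarrow> gentiling r T \<D> \<and> (\<forall>D\<in>\<D>. \<forall>D'\<in>\<D>. congruent_sets D D')"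

text \<open>The vertices of \<open>T\<close> are its extreme points. A tile contained in \<open>T\<close> that contains a
  vertex of \<open>T\<close> has it as a vertex of its own, so membership expresses that the tile meets
  that vertex.\<close>

definition splits_vertex :: "nat \<Rightarrow> point set \<Rightarrow> point set set \<Rightarrow> bool" where
  "splits_vertex k T \<D> \<longleftrightarrow> (\<exists>v. v extreme_point_of T \<and> card {D \<in> \<D>. v \<in> D} = k)"

definition splitting_gentiling :: "nat \<Rightarrow> nat \<Rightarrow> point set \<Rightarrow> point set set \<Rightarrow> bool" where
  "splitting_gentiling k r T \<D> \<longleftrightarrow> k \<ge> 2 \<and> gentiling r T \<D> \<and> splits_vertex k T \<D>"

definition splitting_reptiling :: "nat \<Rightarrow> nat \<Rightarrow> point set \<Rightarrow> point set set \<Rightarrow> bool" where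
  "splitting_reptiling k r T \<D> \<longleftrightarrow> k \<ge> 2 \<and> reptiling r T \<D> \<and> splits_vertex k T \<D>"

end

(* The bisector at B meets AC in D, and BCD is similar to T, so the isosceles triangle ABD with
   angles alpha, alpha, pi - 2 alpha remains. It splits around an inner point O into a triangle
   POD similar to T (P on AD) and two isosceles trapezoids AMOP and BMOD (M on AB) with base
   angle alpha. Such a trapezoid with leg b c and top a^2 consists of three triangles similar to
   T, where a, b, c are the sides of T; a longer top is handled by cutting off a parallelogram
   with angle alpha. With a = 1, t = b = 2 cos alpha and c = t^2 - 1 the sides of that
   parallelogram have ratio in t Q as soon as t^2 is rational, so a grid of copies of T covers it.
   Two tiles meet at B since each of BCD and ABD contributes one. If t itself is rational, all
   similarity ratios are rational, and subdividing each tile into k^2 congruent ones makes all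
   tiles congruent. *)

theory Submission
  imports Defs
begin

text \<open>In units of \<open>s\<close>, POD has sides 1, t, c. Fitting AMOP to three tiles makes
  AP = t c^2, hence AD = t (1 + c^2), the origin of the factor 1 + c^2 in the coordinates. The price
  is paid by BMOD: its legs are 1 and its top is t c^2, while three tiles would need the top 1 / (t
  c). The excess t c^2 - 1 / (t c) = (t / c) (c^3 - 1 / t^2) is one side of the parallelogram, the
  other being 1. A cell made of two tiles has sides in the ratio t / c, so a grid exists once c^3 -
  1 / t^2 is a fraction m / n; it is positive because \<alpha> < pi / 4 means c > 1. Relative to
  vectors of lengths 1 and t along AB and AC, the corners of the large pieces and all inner products
  are rational in c, so similarity of a tile is a polynomial identity with t entering only through
  t^2 = c + 1. Some ratios nevertheless contain an odd power of t, which is why the congruent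
  subdivision asks for rational t.\<close>

subsection \<open>Dissections of convex hulls\<close>

text \<open>Each slice parallel to \<open>f\<close> is an interval whose ends move linearly with the
  height. The inequalities are weak, so a parallel side may shrink to a point and triangles count as
  trapezoids.\<close>

lemma convex_hull_trapezoid:
  fixes X f h :: "'a::real_vector"
  assumes "l0 \<le> r0" "l1 \<le> r1"
  shows "convex hull {X + l0 *\<^sub>R f, X + r0 *\<^sub>R f, X + h + l1 *\<^sub>R f, X + h + r1 *\<^sub>R f}
    = {X + y *\<^sub>R h + x *\<^sub>R f | x y. 0 \<le> y \<and> y \<le> 1 \<and>
         (1 - y) * l0 + y * l1 \<le> x \<and> x \<le> (1 - y) * r0 + y * r1}"
    (is "convex hull ?V = ?Z")
proof
  have "?V \<subseteq> ?Z"
    using assms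
    apply (intro insert_subsetI empty_subsetI)
       apply (rule CollectI, rule exI[of _ l0], rule exI[of _ 0], simp)
      apply (rule CollectI, rule exI[of _ r0], rule exI[of _ 0], simp)
     apply (rule CollectI, rule exI[of _ l1], rule exI[of _ 1], simp)
    apply (rule CollectI, rule exI[of _ r1], rule exI[of _ 1], simp)
    done
  moreover have "convex ?Z"
  proof (rule convexI)
    fix p q and u v :: real
    assume "p \<in> ?Z" "q \<in> ?Z" and uv: "0 \<le> u" "0 \<le> v" "u + v = 1"
    then obtain x y x' y' where p: "p = X + y *\<^sub>R h + x *\<^sub>R f" and q: "q = X + y' *\<^sub>R h + x' *\<^sub>R f"
      and y: "0 \<le> y" "y \<le> 1" and y': "0 \<le> y'" "y' \<le> 1"
      and x: "(1 - y) * l0 + y * l1 \<le> x" "x \<le> (1 - y) * r0 + y * r1"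
      and x': "(1 - y') * l0 + y' * l1 \<le> x'" "x' \<le> (1 - y') * r0 + y' * r1"
      by blast
    have v: "v = 1 - u" using uv by simp
    have "u *\<^sub>R p + v *\<^sub>R q = X + (u * y + v * y') *\<^sub>R h + (u * x + v * x') *\<^sub>R f"
      unfolding p q v by (simp add: algebra_simps)
    moreover have "0 \<le> u * y + v * y'" "u * y + v * y' \<le> 1"
      using uv y y' convex_bound_le[of y 1 y' u v] by auto
    moreover have "(1 - (u * y + v * y')) * a + (u * y + v * y') * b
        = u * ((1 - y) * a + y * b) + v * ((1 - y') * a + y' * b)" for a b
      unfolding v by (simp add: algebra_simps)
    moreover have "u * ((1 - y) * l0 + y * l1) + v * ((1 - y') * l0 + y' * l1) \<le> u * x + v * x'"
      "u * x + v * x' \<le> u * ((1 - y) * r0 + y * r1) + v * ((1 - y') * r0 + y' * r1)"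
      using uv x x' by (auto intro!: add_mono mult_left_mono)
    ultimately show "u *\<^sub>R p + v *\<^sub>R q \<in> ?Z"
      by force
  qed
  ultimately show "convex hull ?V \<subseteq> ?Z"
    by (rule hull_minimal)
  show "?Z \<subseteq> convex hull ?V"
  proof
    fix z assume "z \<in> ?Z"
    then obtain x y where z: "z = X + y *\<^sub>R h + x *\<^sub>R f" and y: "0 \<le> y" "y \<le> 1"
      and x: "(1 - y) * l0 + y * l1 \<le> x" "x \<le> (1 - y) * r0 + y * r1"
      by blast
    then have "x \<in> closed_segment ((1 - y) * l0 + y * l1) ((1 - y) * r0 + y * r1)"
      by (simp add: closed_segment_eq_real_ivl)
    then obtain w where w: "0 \<le> w" "w \<le> 1"
      and xw: "x = (1 - w) * ((1 - y) * l0 + y * l1) + w * ((1 - y) * r0 + y * r1)"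
      by (auto simp: in_segment)
    define p where "p = (1 - w) *\<^sub>R (X + l0 *\<^sub>R f) + w *\<^sub>R (X + r0 *\<^sub>R f)"
    define q where "q = (1 - w) *\<^sub>R (X + h + l1 *\<^sub>R f) + w *\<^sub>R (X + h + r1 *\<^sub>R f)"
    have p: "p \<in> convex hull ?V" and q: "q \<in> convex hull ?V"
      unfolding p_def q_def by (rule convexD_alt[OF convex_convex_hull _ _ w]; simp add: hull_inc)+
    have "z = (1 - y) *\<^sub>R p + y *\<^sub>R q"
      unfolding z p_def q_def xw by (simp add: algebra_simps)
    then show "z \<in> convex hull ?V"
      using convexD_alt[OF convex_convex_hull p q] y by simp
  qed
qed

lemma convex_hull_trapezoid_split:
  fixes X f h :: "'a::real_vector"
  assumes "l0 \<le> m0" "m0 \<le> r0" "l1 \<le> m1" "m1 \<le> r1"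
  shows "convex hull {X + l0 *\<^sub>R f, X + r0 *\<^sub>R f, X + h + l1 *\<^sub>R f, X + h + r1 *\<^sub>R f}
    = convex hull {X + l0 *\<^sub>R f, X + m0 *\<^sub>R f, X + h + l1 *\<^sub>R f, X + h + m1 *\<^sub>R f}
      \<union> convex hull {X + m0 *\<^sub>R f, X + r0 *\<^sub>R f, X + h + m1 *\<^sub>R f, X + h + r1 *\<^sub>R f}"
proof -
  have "(1 - y) * l0 + y * l1 \<le> (1 - y) * m0 + y * m1"
    "(1 - y) * m0 + y * m1 \<le> (1 - y) * r0 + y * r1" if "0 \<le> y" "y \<le> 1" for y
    using that assms by (auto intro!: add_mono mult_left_mono)
  moreover have "l0 \<le> r0" "l1 \<le> r1" using assms by auto
  ultimately show ?thesis
    unfolding convex_hull_trapezoid[OF assms(1,3)] convex_hull_trapezoid[OF assms(2,4)]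
      convex_hull_trapezoid[OF \<open>l0 \<le> r0\<close> \<open>l1 \<le> r1\<close>]
    by (auto; smt (verit))
qed

text \<open>The triangle is a trapezoid on \<open>Q R\<close> whose upper side has shrunk to
  \<open>P\<close>.\<close>

lemma convex_hull_cevian:
  fixes P Q R :: "'a::real_vector"
  assumes "X \<in> closed_segment Q R"
  shows "convex hull {P, Q, R} = convex hull {P, Q, X} \<union> convex hull {P, X, R}"
proof -
  obtain w where w: "0 \<le> w" "w \<le> 1" and X: "X = (1 - w) *\<^sub>R Q + w *\<^sub>R R"
    using assms by (auto simp: in_segment)
  have "X = Q + w *\<^sub>R (R - Q)"
    unfolding X by (simp add: algebra_simps)
  then show ?thesis
    using convex_hull_trapezoid_split[of 0 w 1 0 0 0 Q "R - Q" "P - Q"] w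
    by (simp add: insert_commute)
qed

text \<open>Two cevians, \<open>Q X\<close> and then \<open>X Y\<close>, cut the triangle into
  three; two of the parts lie in the quadrilateral.\<close>

lemma convex_hull_triangle_cut:
  fixes P Q R :: "'a::real_vector"
  assumes Y: "Y \<in> closed_segment P Q" and X: "X \<in> closed_segment P R"
  shows "convex hull {P, Q, R} = convex hull {P, Y, X} \<union> convex hull {Y, X, Q, R}"
proof
  have "convex hull {P, Q, R} = convex hull {Q, P, X} \<union> convex hull {Q, X, R}"
    using convex_hull_cevian[OF X, of Q] by (simp add: insert_commute)
  moreover have "convex hull {Q, P, X} = convex hull {X, P, Y} \<union> convex hull {X, Y, Q}"
    using convex_hull_cevian[OF Y, of X] by (simp add: insert_commute)
  moreover have "convex hull {X, Y, Q} \<subseteq> convex hull {Y, X, Q, R}"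
    "convex hull {Q, X, R} \<subseteq> convex hull {Y, X, Q, R}"
    by (auto intro!: hull_mono)
  ultimately show "convex hull {P, Q, R} \<subseteq> convex hull {P, Y, X} \<union> convex hull {Y, X, Q, R}"
    by (auto simp: insert_commute)
  have "Y \<in> convex hull {P, Q, R}" "X \<in> convex hull {P, Q, R}"
    using Y X hull_mono[of "{P, Q}" "{P, Q, R}" convex] hull_mono[of "{P, R}" "{P, Q, R}" convex]
    by (auto simp: segment_convex_hull)
  then show "convex hull {P, Y, X} \<union> convex hull {Y, X, Q, R} \<subseteq> convex hull {P, Q, R}"
    by (intro Un_least hull_minimal) (auto simp: hull_inc)
qed

subsection \<open>Separation in plane coordinates\<close>

definition cross2 :: "point \<Rightarrow> point \<Rightarrow> real" where
  "cross2 u v = u $ 1 * v $ 2 - u $ 2 * v $ 1"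

lemma inner_point: "(u :: point) \<bullet> v = u $ 1 * v $ 1 + u $ 2 * v $ 2"
  by (simp add: inner_vec_def sum_2)

lemma cross2_bilinear [simp]:
  "cross2 (a + b) w = cross2 a w + cross2 b w" "cross2 w (a + b) = cross2 w a + cross2 w b"
  "cross2 (a - b) w = cross2 a w - cross2 b w" "cross2 w (a - b) = cross2 w a - cross2 w b"
  "cross2 (- a) w = - cross2 a w" "cross2 w (- a) = - cross2 w a"
  "cross2 (r *\<^sub>R a) w = r * cross2 a w" "cross2 w (r *\<^sub>R a) = r * cross2 w a"
  "cross2 a a = 0"
  by (simp_all add: cross2_def algebra_simps)

lemma cross2_commute: "cross2 a b = - cross2 b a"
  by (simp add: cross2_def)

text \<open>Lagrange's identity, the way from prescribed inner products to linear
  independence.\<close>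

lemma cross2_squared: "(cross2 u v)\<^sup>2 = (u \<bullet> u) * (v \<bullet> v) - (u \<bullet> v)\<^sup>2"
  unfolding inner_point cross2_def by algebra

lemma cross2_decompose:
  assumes "cross2 u v \<noteq> 0"
  shows "z = (cross2 z v / cross2 u v) *\<^sub>R u + (cross2 u z / cross2 u v) *\<^sub>R v"
  using assms by (simp add: vec_eq_iff forall_2 divide_simps) (simp add: cross2_def algebra_simps)

text \<open>\<open>n\<close> solves n . u = p and n . v = q by Cramer's rule. Half-planes can thus
  be given in oblique coordinates.\<close>

lemma coordinate_functional:
  assumes "cross2 u v \<noteq> 0" and "p \<noteq> 0 \<or> q \<noteq> 0"
  shows "\<exists>n. n \<noteq> 0 \<and> (\<forall>X x y. n \<bullet> (X + x *\<^sub>R u + y *\<^sub>R v) = n \<bullet> X + (p * x + q * y))"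
proof -
  define n :: point where "n = vector [(p * v $ 2 - q * u $ 2) / cross2 u v, (q * u $ 1 - p * v $ 1) / cross2 u v]"
  have n: "n \<bullet> (x *\<^sub>R u + y *\<^sub>R v) = p * x + q * y" for x y
    using assms(1) unfolding n_def inner_point vector_2
    by (simp add: divide_simps) (simp add: cross2_def algebra_simps)
  then have "n \<bullet> (X + x *\<^sub>R u + y *\<^sub>R v) = n \<bullet> X + (p * x + q * y)" for X x y
    by (metis add.assoc inner_add_right)
  moreover have "n \<noteq> 0"
    using n[of 1 0] n[of 0 1] assms(2) by auto
  ultimately show ?thesis by blast
qed

text \<open>Half-planes are convex, so inequalities at the vertices pass to the hulls, which then
  share only points of one line.\<close>

lemma negligible_convex_hull_Int:
  fixes u v :: point
  assumes "cross2 u v \<noteq> 0" and "p \<noteq> 0 \<or> q \<noteq> 0"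
    and S: "S \<subseteq> (\<lambda>(x, y). X + x *\<^sub>R u + y *\<^sub>R v) ` C" "\<forall>(x, y)\<in>C. p * x + q * y \<le> b"
    and S': "S' \<subseteq> (\<lambda>(x, y). X + x *\<^sub>R u + y *\<^sub>R v) ` C'" "\<forall>(x, y)\<in>C'. b \<le> p * x + q * y"
  shows "negligible (convex hull S \<inter> convex hull S')"
proof -
  obtain n where n: "n \<noteq> 0" "\<forall>X x y. n \<bullet> (X + x *\<^sub>R u + y *\<^sub>R v) = n \<bullet> X + (p * x + q * y)"
    using coordinate_functional[OF assms(1,2)] by blast
  have "S \<subseteq> {z. n \<bullet> z \<le> n \<bullet> X + b}"
    using S n(2) by fastforce
  then have "convex hull S \<subseteq> {z. n \<bullet> z \<le> n \<bullet> X + b}"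
    by (rule hull_minimal) (rule convex_halfspace_le)
  moreover have "S' \<subseteq> {z. n \<bullet> z \<ge> n \<bullet> X + b}"
    using S' n(2) by fastforce
  then have "convex hull S' \<subseteq> {z. n \<bullet> z \<ge> n \<bullet> X + b}"
    by (rule hull_minimal) (rule convex_halfspace_ge)
  ultimately have "convex hull S \<inter> convex hull S' \<subseteq> {z. n \<bullet> z = n \<bullet> X + b}"
    by fastforce
  then show ?thesis
    using negligible_hyperplane n(1) negligible_subset by blast
qed

lemma not_in_convex_hull:
  fixes u v :: point
  assumes "cross2 u v \<noteq> 0" and "p \<noteq> 0 \<or> q \<noteq> 0"
    and "p * x0 + q * y0 < b"
    and S: "S \<subseteq> (\<lambda>(x, y). X + x *\<^sub>R u + y *\<^sub>R v) ` C" "\<forall>(x, y)\<in>C. b \<le> p * x + q * y"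
  shows "X + x0 *\<^sub>R u + y0 *\<^sub>R v \<notin> convex hull S"
proof -
  obtain n where n: "n \<noteq> 0" "\<forall>X x y. n \<bullet> (X + x *\<^sub>R u + y *\<^sub>R v) = n \<bullet> X + (p * x + q * y)"
    using coordinate_functional[OF assms(1,2)] by blast
  have "S \<subseteq> {z. n \<bullet> z \<ge> n \<bullet> X + b}"
    using S n(2) by fastforce
  then have "convex hull S \<subseteq> {z. n \<bullet> z \<ge> n \<bullet> X + b}"
    by (rule hull_minimal) (rule convex_halfspace_ge)
  then show ?thesis
    using n(2) assms(3) by fastforce
qed

lemma negligible_trapezoid_split:
  fixes X f h :: point
  assumes "cross2 f h \<noteq> 0" "l0 \<le> m0" "m0 \<le> r0" "l1 \<le> m1" "m1 \<le> r1"
  shows "negligible (convex hull {X + l0 *\<^sub>R f, X + m0 *\<^sub>R f, X + h + l1 *\<^sub>R f, X + h + m1 *\<^sub>R f}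
      \<inter> convex hull {X + m0 *\<^sub>R f, X + r0 *\<^sub>R f, X + h + m1 *\<^sub>R f, X + h + r1 *\<^sub>R f})"
  \<comment> \<open>x + (m0 - m1) y = m0 is the line through (m0, 0) and (m1, 1), the two ends of
    the cut.\<close>
  by (rule negligible_convex_hull_Int[OF assms(1), where p = 1 and q = "m0 - m1" and b = m0 and X = X
        and C = "{(l0, 0), (m0, 0), (l1, 1), (m1, 1)}" and C' = "{(m0, 0), (r0, 0), (m1, 1), (r1, 1)}"])
     (use assms in \<open>auto simp: add_ac\<close>)

subsection \<open>Tilings by similar triangles\<close>

lemma cross2_imp_not_collinear:
  assumes "cross2 (Q - P) (R - P) \<noteq> 0"
  shows "\<not> collinear {P, Q, R}"
proof
  assume "collinear {P, Q, R}"
  then have "collinear {Q, P, R}" by (simp add: insert_commute)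
  then have "collinear {0, Q - P, R - P}" by (subst (asm) collinear_3) auto
  moreover have "cross2 u v = 0" if "collinear {0, u, v}" for u v
    using that unfolding collinear_lemma by (auto simp: cross2_def)
  ultimately show False
    using assms by blast
qed

lemma noncollinear_imp_simplex:
  fixes P Q R :: point
  assumes "\<not> collinear {P, Q, R}"
  shows "2 simplex (convex hull {P, Q, R})" "interior (convex hull {P, Q, R}) \<noteq> {}"
proof -
  have ai: "\<not> affine_dependent {P, Q, R}" and "P \<noteq> Q" "P \<noteq> R" "Q \<noteq> R"
    using assms unfolding collinear_3_eq_affine_dependent by auto
  then have card: "card {P, Q, R} = 3" by simp
  show "2 simplex (convex hull {P, Q, R})"
    unfolding simplex_def using ai card by (intro exI[of _ "{P, Q, R}"]) simp
  show "interior (convex hull {P, Q, R}) \<noteq> {}"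
    using interior_convex_hull_eq_empty[of "{P, Q, R}"] ai card by simp
qed

text \<open>The reference tile has sides \<open>1\<close>, \<open>t\<close>, \<open>t\<^sup>2 - 1\<close>, where \<open>t\<close> stands for \<open>2 * cos \<alpha>\<close>; in
  \<open>tri \<rho> P Q R\<close> the angles at \<open>P\<close>, \<open>Q\<close>, \<open>R\<close> are \<open>\<alpha>\<close>, \<open>2 * \<alpha>\<close>, \<open>pi - 3 * \<alpha>\<close>.\<close>

locale tile_shape =
  fixes t :: real
  assumes t: "0 < t" "2 < t\<^sup>2" "t\<^sup>2 < 4"
begin

definition c :: real where "c = t\<^sup>2 - 1"

text \<open>The Gram matrix of the sides at \<open>P\<close> fixes the triangle up to congruence,
  reflections included, and is checked by polynomial identities.\<close>

definition tri :: "real \<Rightarrow> point \<Rightarrow> point \<Rightarrow> point \<Rightarrow> bool" where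
  "tri \<rho> P Q R \<longleftrightarrow> (Q - P) \<bullet> (Q - P) = (\<rho> * c)\<^sup>2 \<and> (R - P) \<bullet> (R - P) = (\<rho> * t)\<^sup>2 \<and>
     (Q - P) \<bullet> (R - P) = \<rho>\<^sup>2 * c * t\<^sup>2 / 2"

definition tile :: "real set \<Rightarrow> point set \<Rightarrow> bool" where
  "tile Rs D \<longleftrightarrow> (\<exists>\<rho>\<in>Rs. 0 < \<rho> \<and> (\<exists>P Q R. tri \<rho> P Q R \<and> D = convex hull {P, Q, R}))"

text \<open>Negligible overlaps, unlike disjoint interiors, are visibly stable under unions of regions.\<close>

definition tiled_at :: "real set \<Rightarrow> point \<Rightarrow> nat \<Rightarrow> point set \<Rightarrow> bool" where
  "tiled_at Rs v k S \<longleftrightarrow> (\<exists>\<D>. finite \<D> \<and> \<Union>\<D> = S \<and> (\<forall>D\<in>\<D>. tile Rs D) \<and>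
     pairwise (\<lambda>D D'. negligible (D \<inter> D')) \<D> \<and> card {D \<in> \<D>. v \<in> D} = k)"

definition tiled :: "real set \<Rightarrow> point set \<Rightarrow> bool" where
  "tiled Rs S \<longleftrightarrow> (\<exists>v k. tiled_at Rs v k S)"

text \<open>Fillability of \<open>\<rho>\<close> lets one decomposition serve both parts: a macro tile is either a
  tile itself or is subdivided into congruent tiles.\<close>

definition fillable :: "real set \<Rightarrow> real \<Rightarrow> bool" where
  "fillable Rs \<rho> \<longleftrightarrow> (\<forall>P Q R. \<forall>v\<in>{P, Q, R}. tri \<rho> P Q R \<longrightarrow> tiled_at Rs v 1 (convex hull {P, Q, R}))"

lemma c_gt_1: "1 < c"
  using t by (simp add: c_def)

lemma t_squared: "t\<^sup>2 = c + 1"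
  by (simp add: c_def)

lemma tri_cross2:
  assumes "tri \<rho> P Q R" "\<rho> > 0"
  shows "cross2 (Q - P) (R - P) \<noteq> 0"
proof -
  have "(cross2 (Q - P) (R - P))\<^sup>2 = (\<rho> * c)\<^sup>2 * (\<rho> * t)\<^sup>2 - (\<rho>\<^sup>2 * c * t\<^sup>2 / 2)\<^sup>2"
    using assms unfolding cross2_squared tri_def by (simp only:)
  also have "\<dots> = (\<rho>\<^sup>2 * c * t)\<^sup>2 * (1 - t\<^sup>2 / 4)"
    by (simp add: field_simps power2_eq_square)
  also have "\<dots> > 0"
    using assms c_gt_1 t by (intro mult_pos_pos) auto
  finally show ?thesis by auto
qed

lemma tri_simplex:
  assumes "tri \<rho> P Q R" "\<rho> > 0"
  shows "2 simplex (convex hull {P, Q, R})" "interior (convex hull {P, Q, R}) \<noteq> {}"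
    "\<not> negligible (convex hull {P, Q, R})"
proof -
  note nc = cross2_imp_not_collinear[OF tri_cross2[OF assms]]
  show "2 simplex (convex hull {P, Q, R})" "interior (convex hull {P, Q, R}) \<noteq> {}"
    using noncollinear_imp_simplex[OF nc] by auto
  then show "\<not> negligible (convex hull {P, Q, R})"
    using open_not_negligible interior_subset negligible_subset open_interior by metis
qed

text \<open>The Gram matrices are proportional, so the linear map between the edge vectors
  multiplies every norm by the same factor.\<close>

lemma tri_similar:
  assumes tri: "tri \<rho> P Q R" "tri \<rho>' P' Q' R'" and pos: "0 < \<rho>" "0 < \<rho>'"
  shows "\<exists>f. similarity_with_ratio (\<rho>' / \<rho>) f \<and> f ` (convex hull {P, Q, R}) = convex hull {P', Q', R'}"
proof -
  define u v u' v' where "u = Q - P" "v = R - P" "u' = Q' - P'" "v' = R' - P'"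
  note uv = this
  have cr: "cross2 u v \<noteq> 0"
    using tri_cross2[OF tri(1) pos(1)] by (simp add: uv)
  define L where "L z = (cross2 z v / cross2 u v) *\<^sub>R u' + (cross2 u z / cross2 u v) *\<^sub>R v'" for z
  define r where "r = \<rho>' / \<rho>"
  have r: "r > 0" "\<rho>' = r * \<rho>" using pos by (simp_all add: r_def)
  have lin: "linear L"
    by (rule linearI) (simp_all add: L_def algebra_simps add_divide_distrib)
  have inner: "u' \<bullet> u' = r\<^sup>2 * (u \<bullet> u)" "v' \<bullet> v' = r\<^sup>2 * (v \<bullet> v)" "u' \<bullet> v' = r\<^sup>2 * (u \<bullet> v)"
    using tri unfolding tri_def uv[symmetric] r(2) by (simp_all only: power_mult_distrib mult.assoc times_divide_eq_right)
  have norm: "norm (L z) = r * norm z" for z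
  proof -
    define x y where "x = cross2 z v / cross2 u v" "y = cross2 u z / cross2 u v"
    have z: "z = x *\<^sub>R u + y *\<^sub>R v" and Lz: "L z = x *\<^sub>R u' + y *\<^sub>R v'"
      using cross2_decompose[OF cr, of z] by (simp_all add: x_y_def L_def)
    have sq: "(x *\<^sub>R p + y *\<^sub>R q) \<bullet> (x *\<^sub>R p + y *\<^sub>R q) = x\<^sup>2 * (p \<bullet> p) + y\<^sup>2 * (q \<bullet> q) + 2 * x * y * (p \<bullet> q)"
      for p q :: point
      by (simp add: inner_add_left inner_add_right power2_eq_square inner_commute[of q p] algebra_simps)
    have "(norm (L z))\<^sup>2 = r\<^sup>2 * (norm (x *\<^sub>R u + y *\<^sub>R v))\<^sup>2"
      unfolding power2_norm_eq_inner Lz sq inner by (simp add: algebra_simps)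
    then have "(norm (L z))\<^sup>2 = (r * norm z)\<^sup>2"
      unfolding z[symmetric] by (simp add: power_mult_distrib)
    then show ?thesis
      by (rule power2_eq_imp_eq) (use r in simp_all)
  qed
  define f where "f z = P' + L (z - P)" for z
  have "similarity_with_ratio r f"
    using r norm by (simp add: similarity_with_ratio_def f_def dist_norm linear_diff[OF lin, symmetric])
  moreover have "f ` (convex hull {P, Q, R}) = convex hull {P', Q', R'}"
  proof -
    have f: "f = (\<lambda>z. (P' - L P) + z) \<circ> L"
      by (auto simp: f_def linear_diff[OF lin])
    have "L u = u'" "L v = v'" using cr by (simp_all add: L_def)
    then have "f P = P'" "f Q = Q'" "f R = R'"
      using linear_0[OF lin] by (simp_all add: f_def uv)
    then have "f ` {P, Q, R} = {P', Q', R'}" by simp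
    moreover have "f ` (convex hull S) = convex hull (f ` S)" for S
      unfolding f image_comp[symmetric] convex_hull_linear_image[OF lin] convex_hull_translation ..
    ultimately show ?thesis by simp
  qed
  ultimately show ?thesis unfolding r_def by blast
qed

section \<open>Gluing tilings whose overlap is negligible\<close>

lemma tile_not_negligible: "tile Rs D \<Longrightarrow> \<not> negligible D"
  unfolding tile_def by (elim bexE exE conjE) (simp add: tri_simplex(3))

lemma tileE:
  assumes "tile Rs D"
  obtains \<rho> P Q R where "\<rho> \<in> Rs" "0 < \<rho>" "tri \<rho> P Q R" "D = convex hull {P, Q, R}"
  using assms unfolding tile_def by blast

lemma tiled_at_Un:
  assumes "tiled_at Rs v k S" "tiled_at Rs v l S'" and neg: "negligible (S \<inter> S')"
  shows "tiled_at Rs v (k + l) (S \<union> S')"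
proof -
  obtain \<D> where D: "finite \<D>" "\<Union>\<D> = S" "\<forall>D\<in>\<D>. tile Rs D"
    "pairwise (\<lambda>D D'. negligible (D \<inter> D')) \<D>" "card {D \<in> \<D>. v \<in> D} = k"
    using assms(1) unfolding tiled_at_def by (elim exE conjE) (rule that)
  obtain \<E> where E: "finite \<E>" "\<Union>\<E> = S'" "\<forall>D\<in>\<E>. tile Rs D"
    "pairwise (\<lambda>D D'. negligible (D \<inter> D')) \<E>" "card {D \<in> \<E>. v \<in> D} = l"
    using assms(2) unfolding tiled_at_def by (elim exE conjE) (rule that)
  have cross: "negligible (D \<inter> D')" if "D \<in> \<D>" "D' \<in> \<E>" for D D'
  proof (rule negligible_subset[OF neg])
    have "D \<subseteq> S" "D' \<subseteq> S'"
      using D(2) E(2) that by auto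
    then show "D \<inter> D' \<subseteq> S \<inter> S'" by (rule Int_mono)
  qed
  \<comment> \<open>A common tile would lie in the negligible overlap. Since the families are
    disjoint, the counts at \<open>v\<close> add.\<close>
  have disj: "\<D> \<inter> \<E> = {}"
  proof (rule ccontr)
    assume "\<D> \<inter> \<E> \<noteq> {}"
    then obtain D where "D \<in> \<D>" "D \<in> \<E>" by blast
    moreover from this have "negligible D" using cross[of D D] by simp
    ultimately show False using tile_not_negligible D(3) by blast
  qed
  have "{D \<in> \<D> \<union> \<E>. v \<in> D} = {D \<in> \<D>. v \<in> D} \<union> {D \<in> \<E>. v \<in> D}" by blast
  then have "card {D \<in> \<D> \<union> \<E>. v \<in> D} = k + l"
    using D(1,5) E(1,5) disj
    by (simp add: card_Un_disjoint disjoint_iff)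
  moreover have "pairwise (\<lambda>D D'. negligible (D \<inter> D')) (\<D> \<union> \<E>)"
  proof (rule pairwiseI)
    fix D D' assume "D \<in> \<D> \<union> \<E>" "D' \<in> \<D> \<union> \<E>" "D \<noteq> D'"
    then consider "D \<in> \<D>" "D' \<in> \<D>" | "D \<in> \<E>" "D' \<in> \<E>" | "D \<in> \<D>" "D' \<in> \<E>" | "D' \<in> \<D>" "D \<in> \<E>"
      by blast
    then show "negligible (D \<inter> D')"
      using pairwiseD[OF D(4) _ _ \<open>D \<noteq> D'\<close>] pairwiseD[OF E(4) _ _ \<open>D \<noteq> D'\<close>] cross[of D D'] cross[of D' D]
      by cases (simp_all add: Int_commute)
  qed
  ultimately show ?thesis
    unfolding tiled_at_def using D(1-3) E(1-3)
    by (intro exI[of _ "\<D> \<union> \<E>"]) (simp add: ball_Un)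
qed

text \<open>The count at any other point is read off from the same tiling, so the point hidden in
  \<open>tiled\<close> does not matter.\<close>

lemma tiled_imp_ex_tiled_at: "tiled Rs S \<Longrightarrow> \<exists>k. tiled_at Rs v k S"
  unfolding tiled_def tiled_at_def by blast

lemma tiled_Un:
  assumes "tiled Rs S" "tiled Rs S'" "negligible (S \<inter> S')"
  shows "tiled Rs (S \<union> S')"
proof -
  obtain v k l where "tiled_at Rs v k S" "tiled_at Rs v l S'"
    using assms(1,2) tiled_imp_ex_tiled_at unfolding tiled_def by blast
  then show ?thesis
    using tiled_at_Un assms(3) unfolding tiled_def by blast
qed

lemma tiled_at_0:
  assumes "tiled Rs S" "v \<notin> S"
  shows "tiled_at Rs v 0 S"
proof -
  obtain k where k: "tiled_at Rs v k S"
    using assms(1) tiled_imp_ex_tiled_at by blast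
  moreover have "k = 0"
  proof -
    obtain \<D> where "\<Union>\<D> = S" and k: "card {D \<in> \<D>. v \<in> D} = k"
      using k unfolding tiled_at_def by blast
    then have "{D \<in> \<D>. v \<in> D} = {}" using assms(2) by blast
    then show ?thesis using k by (metis card.empty)
  qed
  ultimately show ?thesis by simp
qed

lemma tiled_at_Un_left:
  assumes "tiled_at Rs v k S" "tiled Rs S'" "negligible (S \<inter> S')" "v \<notin> S'"
  shows "tiled_at Rs v k (S \<union> S')"
  using tiled_at_Un[OF assms(1) tiled_at_0[OF assms(2,4)] assms(3)] by simp

lemma tiled_trapezoid_Un:
  fixes X f h :: point
  assumes "cross2 f h \<noteq> 0" "l0 \<le> m0" "m0 \<le> r0" "l1 \<le> m1" "m1 \<le> r1"
    and "tiled Rs (convex hull {X + l0 *\<^sub>R f, X + m0 *\<^sub>R f, X + h + l1 *\<^sub>R f, X + h + m1 *\<^sub>R f})"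
    and "tiled Rs (convex hull {X + m0 *\<^sub>R f, X + r0 *\<^sub>R f, X + h + m1 *\<^sub>R f, X + h + r1 *\<^sub>R f})"
  shows "tiled Rs (convex hull {X + l0 *\<^sub>R f, X + r0 *\<^sub>R f, X + h + l1 *\<^sub>R f, X + h + r1 *\<^sub>R f})"
  unfolding convex_hull_trapezoid_split[OF assms(2-5)]
  using negligible_trapezoid_split[OF assms(1-5)] assms(6,7) by (rule tiled_Un[rotated 2])

lemma tiled_singleton:
  assumes "tri \<rho> P Q R" "0 < \<rho>" "\<rho> \<in> Rs" "v \<in> {P, Q, R}"
  shows "tiled_at Rs v 1 (convex hull {P, Q, R})"
proof -
  have "v \<in> convex hull {P, Q, R}" using assms(4) by (rule hull_inc)
  then have "{D \<in> {convex hull {P, Q, R}}. v \<in> D} = {convex hull {P, Q, R}}" by blast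
  then have "card {D \<in> {convex hull {P, Q, R}}. v \<in> D} = 1" by simp
  moreover have "tile Rs (convex hull {P, Q, R})"
    using assms unfolding tile_def by blast
  ultimately show ?thesis
    unfolding tiled_at_def
    by (intro exI[of _ "{convex hull {P, Q, R}}"] conjI) (simp_all add: pairwise_def)
qed

lemma fillable_mem: "0 < \<rho> \<Longrightarrow> \<rho> \<in> Rs \<Longrightarrow> fillable Rs \<rho>"
  unfolding fillable_def using tiled_singleton by blast

lemma fillable_tiled_at:
  assumes "fillable Rs \<rho>" "tri \<rho> P Q R" "v \<in> {P, Q, R}"
  shows "tiled_at Rs v 1 (convex hull {P, Q, R})"
  using assms unfolding fillable_def by blast

lemma fillable_tiled: "fillable Rs \<rho> \<Longrightarrow> tri \<rho> P Q R \<Longrightarrow> tiled Rs (convex hull {P, Q, R})"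
  using fillable_tiled_at[where v = P] unfolding tiled_def by blast

section \<open>Strips, parallelogram grids and the subdivision of a tile\<close>

lemma tiled_strip:
  fixes f g :: point
  assumes fg: "cross2 f g \<noteq> 0"
    and up: "\<And>Y. tiled Rs (convex hull {Y, Y + g, Y + g + f})"
    and down: "\<And>Y. tiled Rs (convex hull {Y, Y + f, Y + g + f})"
  shows "tiled Rs (convex hull {Y, Y + real j *\<^sub>R f, Y + g, Y + g + real (Suc j) *\<^sub>R f})"
    and "0 < j \<Longrightarrow> tiled Rs (convex hull {Y, Y + real j *\<^sub>R f, Y + g, Y + g + real j *\<^sub>R f})"
proof -
  \<comment> \<open>Copies of \<open>up\<close> and \<open>down\<close> alternate:
    \<open>j + 1\<close> of the former and \<open>j\<close> of the latter fill the trapezoid with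
    upper side \<open>j + 1\<close>, and one more \<open>down\<close> closes it to a
    parallelogram.\<close>
  have step: "tiled Rs (convex hull {Y, Y + real (Suc j) *\<^sub>R f, Y + g, Y + g + real (Suc j) *\<^sub>R f})"
    if "tiled Rs (convex hull {Y, Y + real j *\<^sub>R f, Y + g, Y + g + real (Suc j) *\<^sub>R f})" for j
  proof -
    have "tiled Rs (convex hull {Y + real j *\<^sub>R f, Y + real (Suc j) *\<^sub>R f, Y + g + real (Suc j) *\<^sub>R f})"
      using down[of "Y + real j *\<^sub>R f"] by (simp add: algebra_simps)
    then show ?thesis
      using tiled_trapezoid_Un[OF fg, of 0 j "Suc j" 0 "Suc j" "Suc j" Rs Y] that by simp
  qed
  have all: "tiled Rs (convex hull {Y, Y + real j *\<^sub>R f, Y + g, Y + g + real (Suc j) *\<^sub>R f})" for j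
  proof (induction j)
    case 0
    then show ?case using up by simp
  next
    case (Suc j)
    have "tiled Rs (convex hull {Y + real (Suc j) *\<^sub>R f, Y + g + real (Suc j) *\<^sub>R f, Y + g + real (Suc (Suc j)) *\<^sub>R f})"
      using up[of "Y + real (Suc j) *\<^sub>R f"] by (simp only: of_nat_Suc scaleR_left_distrib scaleR_one add_ac)
    then show ?case
      using tiled_trapezoid_Un[OF fg, of 0 "Suc j" "Suc j" 0 "Suc j" "Suc (Suc j)" Rs Y] step[OF Suc.IH]
      by simp
  qed
  show "tiled Rs (convex hull {Y, Y + real j *\<^sub>R f, Y + g, Y + g + real (Suc j) *\<^sub>R f})"
    by (rule all)
  show "tiled Rs (convex hull {Y, Y + real j *\<^sub>R f, Y + g, Y + g + real j *\<^sub>R f})" if "0 < j"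
    using step[OF all[of "j - 1"]] that by simp
qed

lemma tiled_parallelogram:
  fixes f g :: point
  assumes fg: "cross2 f g \<noteq> 0" and "0 < m" "0 < n"
    and up: "\<And>Y. tiled Rs (convex hull {Y, Y + g, Y + g + f})"
    and down: "\<And>Y. tiled Rs (convex hull {Y, Y + f, Y + g + f})"
  shows "tiled Rs (convex hull {Y, Y + real m *\<^sub>R f, Y + real n *\<^sub>R g, Y + real m *\<^sub>R f + real n *\<^sub>R g})"
  using \<open>0 < n\<close>
proof (induction n rule: nat_induct_non_zero)
  case 1
  then show ?case
    using tiled_strip(2)[OF fg up down \<open>0 < m\<close>, of Y] by (simp add: algebra_simps)
next
  case (Suc n)
  \<comment> \<open>Rows are stacked along \<open>g\<close>, so \<open>g\<close> now plays the
    parallel direction and \<open>m\<close> times \<open>f\<close> the height.\<close>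
  have "cross2 g (real m *\<^sub>R f) \<noteq> 0"
    using fg \<open>0 < m\<close> cross2_commute[of f g] by simp
  moreover have "tiled Rs (convex hull {Y + real n *\<^sub>R g, Y + real (Suc n) *\<^sub>R g,
      Y + real m *\<^sub>R f + real n *\<^sub>R g, Y + real m *\<^sub>R f + real (Suc n) *\<^sub>R g})"
    using tiled_strip(2)[OF fg up down \<open>0 < m\<close>, of "Y + real n *\<^sub>R g"]
    by (simp add: algebra_simps insert_commute)
  ultimately show ?case
    using tiled_trapezoid_Un[of g "real m *\<^sub>R f" 0 n "Suc n" 0 n "Suc n" Rs Y] Suc.IH
    by (simp add: insert_commute)
qed

text \<open>The triangle grows by one row along the side opposite \<open>P\<close>. New rows avoid
  \<open>P\<close>, so that corner stays in a single tile.\<close>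

lemma tiled_subdivision:
  fixes u v :: point
  assumes uv: "cross2 u v \<noteq> 0" and "0 < k"
    and up: "\<And>Y. tiled Rs (convex hull {Y, Y + u, Y + v})"
    and up_at: "tiled_at Rs P 1 (convex hull {P, P + u, P + v})"
    and down: "\<And>Y. tiled Rs (convex hull {Y, Y - u, Y - v})"
  shows "tiled_at Rs P 1 (convex hull {P, P + real k *\<^sub>R u, P + real k *\<^sub>R v})"
  using \<open>0 < k\<close>
proof (induction k rule: nat_induct_non_zero)
  case 1
  then show ?case using up_at by simp
next
  case (Suc k)
  let ?Y = "P + real k *\<^sub>R u" and ?X = "P + real k *\<^sub>R v"
  let ?Q = "P + real (Suc k) *\<^sub>R u" and ?R = "P + real (Suc k) *\<^sub>R v"
  have seg: "P + real k *\<^sub>R w \<in> closed_segment P (P + real (Suc k) *\<^sub>R w)" for w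
  proof -
    have "(1 - a) *\<^sub>R P + a *\<^sub>R (P + b *\<^sub>R w) = P + (a * b) *\<^sub>R w" for a b
      by (simp add: algebra_simps)
    then show ?thesis
      unfolding in_segment by (intro exI[of _ "k / Suc k"]) simp
  qed
  \<comment> \<open>The row is a strip in direction \<open>v - u\<close> with slanted edge
    \<open>u\<close>: \<open>k + 1\<close> translates of the tile and \<open>k\<close> of its point
    reflection.\<close>
  have strip: "tiled Rs (convex hull {?Y, ?X, ?Q, ?R})"
  proof -
    have 1: "tiled Rs (convex hull {Y, Y + u, Y + u + (v - u)})" for Y
      using up[of Y] by simp
    have 2: "tiled Rs (convex hull {Y, Y + (v - u), Y + u + (v - u)})" for Y
      using down[of "Y + v"] by (simp add: algebra_simps insert_commute)
    show ?thesis
      using tiled_strip(1)[OF _ 1 2, of ?Y k] uv cross2_commute[of u v]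
      by (simp add: algebra_simps)
  qed
  have neg: "negligible (convex hull {P, ?Y, ?X} \<inter> convex hull {?Y, ?X, ?Q, ?R})"
    by (rule negligible_convex_hull_Int[OF uv, where p = 1 and q = 1 and b = k and X = P
          and C = "{(0, 0), (k, 0), (0, k)}" and C' = "{(k, 0), (0, k), (Suc k, 0), (0, Suc k)}"]) auto
  have "P + 0 *\<^sub>R u + 0 *\<^sub>R v \<notin> convex hull {?Y, ?X, ?Q, ?R}"
    by (rule not_in_convex_hull[OF uv, where p = 1 and q = 1 and b = k
          and C = "{(k, 0), (0, k), (Suc k, 0), (0, Suc k)}"]) (use Suc.hyps in auto)
  then show ?case
    unfolding convex_hull_triangle_cut[OF seg[of u] seg[of v]]
    using tiled_at_Un_left[OF Suc.IH strip neg] by simp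
qed

lemma fillable_multiple:
  assumes "0 < \<rho>" "0 < k"
  shows "fillable {\<rho>} (real k * \<rho>)"
  unfolding fillable_def
proof (intro allI ballI impI)
  fix P Q R v assume v: "v \<in> {P, Q, R}" and tri: "tri (real k * \<rho>) P Q R"
  \<comment> \<open>Shrinking about the origin gives a tile of ratio \<open>\<rho>\<close> whose
    translates and point reflections fill the triangle.\<close>
  define p q r where "p = P /\<^sub>R k" "q = Q /\<^sub>R k" "r = R /\<^sub>R k"
  have PQR: "P = k *\<^sub>R p" "Q = k *\<^sub>R q" "R = k *\<^sub>R r"
    using \<open>0 < k\<close> by (simp_all add: p_q_r_def)
  have tri': "tri \<rho> p q r"
  proof -
    have "k *\<^sub>R y - k *\<^sub>R x = k *\<^sub>R (y - x)" for x y :: point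
      by (simp add: scaleR_diff_right)
    then have "k\<^sup>2 * ((q - p) \<bullet> (q - p)) = k\<^sup>2 * (\<rho> * c)\<^sup>2" "k\<^sup>2 * ((r - p) \<bullet> (r - p)) = k\<^sup>2 * (\<rho> * t)\<^sup>2"
      "k\<^sup>2 * ((q - p) \<bullet> (r - p)) = k\<^sup>2 * (\<rho>\<^sup>2 * c * t\<^sup>2 / 2)"
      using tri unfolding tri_def PQR by (simp_all add: power2_eq_square mult_ac)
    then show ?thesis
      using \<open>0 < k\<close> unfolding tri_def by simp
  qed
  have "(Y + y) - (Y + x) = y - x" "(Y - y) - (Y - x) = - (y - x)" for Y x y :: point
    by simp_all
  then have tris: "tri \<rho> (Y + p) (Y + q) (Y + r)" "tri \<rho> (Y - p) (Y - q) (Y - r)" for Y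
    using tri' unfolding tri_def by (simp_all only: inner_minus_left inner_minus_right minus_minus)
  have base: "tiled_at {\<rho>} w 1 (convex hull {Y + p, Y + q, Y + r})"
    if "w \<in> {Y + p, Y + q, Y + r}" for w Y
    by (rule tiled_singleton[OF tris(1)]) (use that \<open>0 < \<rho>\<close> in auto)
  have base': "tiled {\<rho>} (convex hull {Y + p, Y + q, Y + r})" "tiled {\<rho>} (convex hull {Y - p, Y - q, Y - r})" for Y
    using tiled_singleton[OF tris(1), of "{\<rho>}"] tiled_singleton[OF tris(2), of "{\<rho>}"] \<open>0 < \<rho>\<close>
    unfolding tiled_def by blast+
  \<comment> \<open>Growth by rows controls the count only at the corner where it starts, so it is
    run from each of the three corners.\<close>
  have main: "tiled_at {\<rho>} (k *\<^sub>R a) 1 (convex hull {k *\<^sub>R a, k *\<^sub>R b, k *\<^sub>R d})"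
    if cr: "cross2 (b - a) (d - a) \<noteq> 0" and eq: "{a, b, d} = {p, q, r}" for a b d
  proof -
    have im: "{Y + a, Y + b, Y + d} = {Y + p, Y + q, Y + r}" "{Y - a, Y - b, Y - d} = {Y - p, Y - q, Y - r}" for Y
      using arg_cong[OF eq, of "image (\<lambda>z. Y + z)"] arg_cong[OF eq, of "image (\<lambda>z. Y - z)"] by simp_all
    have 1: "tiled {\<rho>} (convex hull {Y, Y + (b - a), Y + (d - a)})" for Y
      using base'(1)[of "Y - a"] im(1)[of "Y - a"] by (simp add: algebra_simps)
    have 2: "tiled {\<rho>} (convex hull {Y, Y - (b - a), Y - (d - a)})" for Y
      using base'(2)[of "Y + a"] im(2)[of "Y + a"] by (simp add: algebra_simps)
    have "a \<in> {p, q, r}" using eq by blast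
    then have 3: "tiled_at {\<rho>} (k *\<^sub>R a) 1 (convex hull {k *\<^sub>R a, k *\<^sub>R a + (b - a), k *\<^sub>R a + (d - a)})"
      using base[of "k *\<^sub>R a" "k *\<^sub>R a - a"] im(1)[of "k *\<^sub>R a - a"] by (auto simp: algebra_simps)
    show ?thesis
      using tiled_subdivision[OF cr \<open>0 < k\<close> 1 3 2] by (simp add: algebra_simps)
  qed
  have cr: "cross2 (q - p) (r - p) \<noteq> 0"
    using tri_cross2[OF tri' \<open>0 < \<rho>\<close>] .
  have swap: "{q, p, r} = {p, q, r}" "{r, p, q} = {p, q, r}" for p q r :: point
    by auto
  have cr': "cross2 (p - q) (r - q) \<noteq> 0" "cross2 (p - r) (q - r) \<noteq> 0"
    using cr by (simp_all add: cross2_def algebra_simps)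
  have "tiled_at {\<rho>} Q 1 (convex hull {P, Q, R})" "tiled_at {\<rho>} R 1 (convex hull {P, Q, R})"
    using main[OF cr'(1) swap(1)] main[OF cr'(2) swap(2)]
    unfolding PQR by (simp_all add: swap[where p = "k *\<^sub>R p" and q = "k *\<^sub>R q" and r = "k *\<^sub>R r"])
  moreover have "tiled_at {\<rho>} P 1 (convex hull {P, Q, R})"
    using main[OF cr refl] unfolding PQR .
  ultimately show "tiled_at {\<rho>} v 1 (convex hull {P, Q, R})"
    using v by blast
qed

subsection \<open>Splitting the triangle\<close>

text \<open>The left-hand sides are the inner products in the basis \<open>E1\<close>,
  \<open>E2\<close>, in units of s^2 and with t^2 already replaced by c + 1.\<close>

lemma tri_if_coordinates:
  assumes E: "E1 \<bullet> E1 = s\<^sup>2" "E2 \<bullet> E2 = s\<^sup>2 * t\<^sup>2" "E1 \<bullet> E2 = s\<^sup>2 * t\<^sup>2 / 2"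
    and QR: "Q - P = x *\<^sub>R E1 + y *\<^sub>R E2" "R - P = x' *\<^sub>R E1 + y' *\<^sub>R E2"
    and eqs: "x\<^sup>2 + (c + 1) * y\<^sup>2 + (c + 1) * (x * y) = \<rho>\<^sup>2 * c\<^sup>2"
      "x'\<^sup>2 + (c + 1) * y'\<^sup>2 + (c + 1) * (x' * y') = \<rho>\<^sup>2 * (c + 1)"
      "x * x' + (c + 1) * (y * y') + (c + 1) / 2 * (x * y' + x' * y) = \<rho>\<^sup>2 * c * (c + 1) / 2"
  shows "tri (s * \<rho>) P Q R"
proof -
  have inner: "(a *\<^sub>R E1 + b *\<^sub>R E2) \<bullet> (a' *\<^sub>R E1 + b' *\<^sub>R E2)
      = s\<^sup>2 * (a * a' + (c + 1) * (b * b') + (c + 1) / 2 * (a * b' + a' * b))" for a b a' b'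
    by (simp add: inner_add_left inner_add_right E inner_commute[of E2 E1] t_squared) algebra
  have "(Q - P) \<bullet> (Q - P) = s\<^sup>2 * (x\<^sup>2 + (c + 1) * y\<^sup>2 + (c + 1) * (x * y))"
    "(R - P) \<bullet> (R - P) = s\<^sup>2 * (x'\<^sup>2 + (c + 1) * y'\<^sup>2 + (c + 1) * (x' * y'))"
    unfolding QR inner by algebra+
  moreover have "(Q - P) \<bullet> (R - P) = s\<^sup>2 * (\<rho>\<^sup>2 * c * (c + 1) / 2)"
    unfolding QR inner eqs ..
  ultimately show ?thesis
    unfolding tri_def eqs by (simp add: power_mult_distrib t_squared mult_ac)
qed

end

text \<open>\<open>E1\<close> and \<open>E2\<close> point along \<open>AB\<close> and \<open>AC\<close> and are scaled so that the triangle \<open>vP vO vD\<close>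
  of the decomposition has ratio \<open>s\<close>.\<close>

locale split_triangle = tile_shape +
  fixes A E1 E2 :: point and s :: real and m n :: nat
  assumes s: "0 < s"
    and E: "E1 \<bullet> E1 = s\<^sup>2" "E2 \<bullet> E2 = s\<^sup>2 * t\<^sup>2" "E1 \<bullet> E2 = s\<^sup>2 * t\<^sup>2 / 2"
    and mn: "0 < m" "0 < n" "c ^ 3 - 1 / t\<^sup>2 = m / n"
begin

section \<open>Coordinates along the two sides at \<open>A\<close>\<close>

definition pt :: "real \<Rightarrow> real \<Rightarrow> point" where
  "pt x y = A + x *\<^sub>R E1 + y *\<^sub>R E2"

lemma cross2_E: "cross2 E1 E2 \<noteq> 0"
proof -
  have "(cross2 E1 E2)\<^sup>2 = s\<^sup>2 * (s\<^sup>2 * t\<^sup>2) - (s\<^sup>2 * t\<^sup>2 / 2)\<^sup>2"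
    unfolding cross2_squared E ..
  also have "\<dots> = (s\<^sup>2 * t)\<^sup>2 * (1 - t\<^sup>2 / 4)"
    by (simp add: field_simps power2_eq_square)
  also have "\<dots> > 0"
    using s t by (intro mult_pos_pos) auto
  finally show ?thesis by auto
qed

text \<open>\<open>q\<close> keeps \<open>t\<close> out of the equations: ratios may contain it, but
  their squares are rational in \<open>c\<close>.\<close>

lemma tri_pt:
  assumes "(a' - a)\<^sup>2 + (c + 1) * (b' - b)\<^sup>2 + (c + 1) * ((a' - a) * (b' - b)) = q * c\<^sup>2"
      "(a'' - a)\<^sup>2 + (c + 1) * (b'' - b)\<^sup>2 + (c + 1) * ((a'' - a) * (b'' - b)) = q * (c + 1)"
      "(a' - a) * (a'' - a) + (c + 1) * ((b' - b) * (b'' - b))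
        + (c + 1) / 2 * ((a' - a) * (b'' - b) + (a'' - a) * (b' - b)) = q * c * (c + 1) / 2"
    and "\<rho>\<^sup>2 = q"
  shows "tri (s * \<rho>) (pt a b) (pt a' b') (pt a'' b'')"
  by (rule tri_if_coordinates[OF E, where x = "a' - a" and y = "b' - b" and x' = "a'' - a" and y' = "b'' - b"])
     (use assms in \<open>simp_all add: pt_def algebra_simps\<close>)

lemma pt_closed_segment:
  assumes "0 \<le> w" "w \<le> 1" "x = (1 - w) * a + w * a'" "y = (1 - w) * b + w * b'"
  shows "pt x y \<in> closed_segment (pt a b) (pt a' b')"
  unfolding in_segment assms(3,4) using assms(1,2)
  by (intro exI[of _ w]) (simp add: pt_def algebra_simps)

lemma pt_axis_segment:
  assumes "a \<le> x" "x \<le> a'"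
  shows "pt x y \<in> closed_segment (pt a y) (pt a' y)" "pt y x \<in> closed_segment (pt y a) (pt y a')"
proof -
  have "x \<in> closed_segment a a'"
    using assms by (simp add: closed_segment_eq_real_ivl)
  then obtain w where "0 \<le> w" "w \<le> 1" "x = (1 - w) * a + w * a'"
    by (auto simp: in_segment)
  then show "pt x y \<in> closed_segment (pt a y) (pt a' y)" "pt y x \<in> closed_segment (pt y a) (pt y a')"
    by (auto intro!: pt_closed_segment[of w] simp: algebra_simps)
qed

lemma negligible_pt:
  assumes "p \<noteq> 0 \<or> q \<noteq> 0"
    and "\<forall>(x, y)\<in>C. p * x + q * y \<le> b" "\<forall>(x, y)\<in>C'. b \<le> p * x + q * y"
  shows "negligible (convex hull ((\<lambda>(x, y). pt x y) ` C) \<inter> convex hull ((\<lambda>(x, y). pt x y) ` C'))"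
  unfolding pt_def using negligible_convex_hull_Int[OF cross2_E assms(1) order_refl assms(2) order_refl assms(3)] .

lemma pt_notin:
  assumes "p \<noteq> 0 \<or> q \<noteq> 0" "p * x0 + q * y0 < b" "\<forall>(x, y)\<in>C. b \<le> p * x + q * y"
  shows "pt x0 y0 \<notin> convex hull ((\<lambda>(x, y). pt x y) ` C)"
  unfolding pt_def using not_in_convex_hull[OF cross2_E assms(1,2) order_refl assms(3)] .

text \<open>\<open>vD\<close> is the foot of the bisector at \<open>vB\<close>, and \<open>F\<close> is the direction of \<open>vB vD\<close>. The
  point \<open>vP\<close> on \<open>vA vD\<close> could be chosen freely, with \<open>vO\<close> and \<open>vM\<close> determined by the directions
  of the edges; this choice makes \<open>vA vM vP vO\<close> the trapezoid that three tiles cover.\<close>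

definition "vA = pt 0 0"
definition "vB = pt ((c + 1) * (1 + c\<^sup>2)) 0"
definition "vC = pt 0 ((c + 1) * (1 + c\<^sup>2) / c)"
definition "vD = pt 0 (1 + c\<^sup>2)"
definition "vP = pt 0 (c\<^sup>2)"
definition "vO = pt c (c\<^sup>2)"
definition "vM = pt (c + c\<^sup>2 + c ^ 3) 0"
definition "F = E2 - (c + 1) *\<^sub>R E1"

lemma scale_F: "r *\<^sub>R F = (- (r * (c + 1))) *\<^sub>R E1 + r *\<^sub>R E2"
  by (simp add: F_def algebra_simps)

text \<open>In the frame \<open>F\<close>, \<open>- E1\<close> at \<open>vB\<close> the bases
  \<open>vB vD\<close> and \<open>vM vO\<close> of the second trapezoid lie at heights 0 and
  1.\<close>

lemma base_F: "vB + l *\<^sub>R F = pt ((c + 1) * (1 + c\<^sup>2) - (c + 1) * l) l"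
  by (simp add: vB_def pt_def F_def algebra_simps)

lemma top_F: "vB + - E1 + l *\<^sub>R F = pt (c + c\<^sup>2 + c ^ 3 - (c + 1) * l) l"
  by (simp add: vB_def pt_def F_def algebra_simps power2_eq_square power3_eq_cube)

lemma vD_F: "vD = vB + (1 + c\<^sup>2) *\<^sub>R F"
  unfolding base_F by (simp add: vD_def)

lemma vO_F: "vO = vB + - E1 + c\<^sup>2 *\<^sub>R F"
  unfolding top_F by (simp add: vO_def algebra_simps power2_eq_square power3_eq_cube)

lemma vM_F: "vM = vB + - E1 + 0 *\<^sub>R F"
  unfolding top_F by (simp add: vM_def)

lemma cross2_F: "cross2 F (- E1) \<noteq> 0"
  using cross2_E cross2_commute[of E1 E2] by (simp add: F_def)

text \<open>In order, the ratios belong to BCD, to POD, to the three tiles of AMOP, to the same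
  three divided by t c^2 inside BMOD, and to the cells of the grid.\<close>

context
  fixes Rs
  assumes fill: "\<And>\<rho>. \<rho> \<in> {t * (1 + c\<^sup>2) / c, 1, t * c, c\<^sup>2, c, 1 / c, 1 / t, 1 / (t * c), 1 / (c * n)}
    \<Longrightarrow> fillable Rs (s * \<rho>)"
begin

section \<open>Tilings of the four pieces\<close>

lemma tiled_BCD: "tiled_at Rs vB 1 (convex hull {vB, vD, vC})"
proof (rule fillable_tiled_at[OF fill])
  show "tri (s * (t * (1 + c\<^sup>2) / c)) vB vD vC"
    unfolding vB_def vD_def vC_def
  proof (rule tri_pt[where q = "(c + 1) * (1 + c\<^sup>2)\<^sup>2 / c\<^sup>2"])
    show "(t * (1 + c\<^sup>2) / c)\<^sup>2 = (c + 1) * (1 + c\<^sup>2)\<^sup>2 / c\<^sup>2"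
      by (simp add: power_mult_distrib power_divide t_squared)
  qed (use c_gt_1 in \<open>simp_all add: field_simps, algebra+\<close>)
qed simp_all

lemma tiled_POD: "tiled Rs (convex hull {vP, vO, vD})"
proof (rule fillable_tiled[OF fill])
  show "tri (s * 1) vP vO vD"
    unfolding vP_def vO_def vD_def by (rule tri_pt[where q = 1]) (simp_all add: field_simps)
qed simp

text \<open>The point \<open>pt ((c + 1) * c) 0\<close> is placed so that it forms a tile with
  \<open>vA vP\<close> as the side \<open>c\<close>. Joined to \<open>vP\<close> and
  \<open>vO\<close>, it leaves two more tiles.\<close>

lemma tiled_AMOP: "tiled Rs (convex hull {vA, vM, vP, vO})"
proof -
  have "tiled Rs (convex hull {pt 0 0, pt 0 (c\<^sup>2), pt ((c + 1) * c) 0})"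
  proof (rule fillable_tiled[OF fill])
    show "tri (s * (t * c)) (pt 0 0) (pt 0 (c\<^sup>2)) (pt ((c + 1) * c) 0)"
      by (rule tri_pt[where q = "(c + 1) * c\<^sup>2"]) (simp_all add: power_mult_distrib t_squared, algebra+)
  qed simp
  moreover have "tiled Rs (convex hull {pt ((c + 1) * c) 0, pt c (c\<^sup>2), pt 0 (c\<^sup>2)})"
  proof (rule fillable_tiled[OF fill])
    show "tri (s * c) (pt ((c + 1) * c) 0) (pt c (c\<^sup>2)) (pt 0 (c\<^sup>2))"
      by (rule tri_pt[where q = "c\<^sup>2"]) (simp_all, algebra+)
  qed simp
  moreover have "tiled Rs (convex hull {pt (c + c\<^sup>2 + c ^ 3) 0, pt ((c + 1) * c) 0, pt c (c\<^sup>2)})"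
  proof (rule fillable_tiled[OF fill])
    show "tri (s * c\<^sup>2) (pt (c + c\<^sup>2 + c ^ 3) 0) (pt ((c + 1) * c) 0) (pt c (c\<^sup>2))"
      by (rule tri_pt[where q = "c ^ 4"]) (simp_all, algebra+)
  qed simp
  moreover have pts: "A + x *\<^sub>R E1 = pt x 0" "A + c\<^sup>2 *\<^sub>R E2 + x *\<^sub>R E1 = pt x (c\<^sup>2)" for x
    by (simp_all add: pt_def)
  moreover have "cross2 E1 (c\<^sup>2 *\<^sub>R E2) \<noteq> 0"
    using cross2_E c_gt_1 by simp
  moreover have "vA = A" "pt 0 0 = A" by (simp_all add: vA_def pt_def)
  ultimately show ?thesis
    using tiled_trapezoid_Un[of E1 "c\<^sup>2 *\<^sub>R E2" "(c + 1) * c" "(c + 1) * c" "c + c\<^sup>2 + c ^ 3" 0 c c Rs A]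
      tiled_trapezoid_Un[of E1 "c\<^sup>2 *\<^sub>R E2" 0 "(c + 1) * c" "c + c\<^sup>2 + c ^ 3" 0 0 c Rs A] c_gt_1
    unfolding pts vM_def vP_def vO_def
    by (simp add: insert_commute power2_eq_square algebra_simps)
qed

text \<open>The hypothesis on \<open>m / n\<close> is exactly what makes the cells of an \<open>m\<close> by \<open>n\<close> grid in this
  parallelogram split into two tiles along a diagonal.\<close>

lemma tiled_GHOD:
  defines "g \<equiv> (c + 1 + c\<^sup>2) / ((c + 1) * c)" and "h \<equiv> 1 / ((c + 1) * c)"
  shows "tiled Rs (convex hull {vB + g *\<^sub>R F, vD, vB + - E1 + h *\<^sub>R F, vO})"
proof -
  define f' where "f' = (1 / (n * c)) *\<^sub>R F"
  have f'_F: "f' = (- ((c + 1) / (n * c))) *\<^sub>R E1 + (1 / (n * c)) *\<^sub>R E2"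
    unfolding f'_def scale_F by simp
  define g' where "g' = (1 / n) *\<^sub>R (c *\<^sub>R E1 - E2)"
  have pos: "0 < c" "0 < real n" using c_gt_1 mn by auto
  have "c ^ 3 - 1 / (c + 1) = m / n"
    using mn(3) unfolding t_squared .
  moreover have "(c ^ 3 - 1 / (c + 1)) / c = c\<^sup>2 - 1 / ((c + 1) * c)"
    using pos by (simp add: diff_divide_distrib power2_eq_square power3_eq_cube)
  ultimately have w: "m / (n * c) = c\<^sup>2 - 1 / ((c + 1) * c)"
    by simp
  have "cross2 f' g' = cross2 E1 E2 / (n\<^sup>2 * c)"
    using pos by (simp add: f'_def g'_def F_def cross2_commute[of E2 E1] field_simps power2_eq_square)
  then have cr: "cross2 f' g' \<noteq> 0"
    using cross2_E pos by simp
  \<comment> \<open>The sides s / n and s t / (c n) of a cell enclose the angle \<alpha>, so they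
    are the sides \<open>c\<close> and \<open>t\<close> of a tile of ratio s / (c n). The diagonal
    joins the other two corners.\<close>
  have up: "tiled Rs (convex hull {Y, Y + g', Y + g' + f'})" for Y
  proof -
    have "tri (s * (1 / (c * n))) (Y + g') Y (Y + g' + f')"
    proof (rule tri_if_coordinates[OF E, where x = "- c / n" and y = "1 / n" and x' = "- ((c + 1) / (n * c))" and y' = "1 / (n * c)"])
      show "Y - (Y + g') = (- c / n) *\<^sub>R E1 + (1 / n) *\<^sub>R E2"
        by (simp add: g'_def algebra_simps)
      show "(Y + g' + f') - (Y + g') = (- ((c + 1) / (n * c))) *\<^sub>R E1 + (1 / (n * c)) *\<^sub>R E2"
        by (simp add: f'_F)
    qed (use pos in \<open>simp_all add: power_divide divide_simps\<close>, (simp_all add: algebra_simps power2_eq_square)?)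
    moreover have "fillable Rs (s * (1 / (c * n)))" by (rule fill) simp
    ultimately have "tiled Rs (convex hull {Y + g', Y, Y + g' + f'})"
      by (rule fillable_tiled[rotated])
    then show ?thesis by (simp add: insert_commute)
  qed
  have down: "tiled Rs (convex hull {Y, Y + f', Y + g' + f'})" for Y
  proof -
    have "tri (s * (1 / (c * n))) (Y + f') (Y + g' + f') Y"
    proof (rule tri_if_coordinates[OF E, where x = "c / n" and y = "- 1 / n" and x' = "(c + 1) / (n * c)" and y' = "- 1 / (n * c)"])
      show "(Y + g' + f') - (Y + f') = (c / n) *\<^sub>R E1 + (- 1 / n) *\<^sub>R E2"
        by (simp add: g'_def algebra_simps)
      show "Y - (Y + f') = ((c + 1) / (n * c)) *\<^sub>R E1 + (- 1 / (n * c)) *\<^sub>R E2"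
        by (simp add: f'_F)
    qed (use pos in \<open>simp_all add: power_divide divide_simps\<close>, (simp_all add: algebra_simps power2_eq_square)?)
    moreover have "fillable Rs (s * (1 / (c * n)))" by (rule fill) simp
    ultimately have "tiled Rs (convex hull {Y + f', Y + g' + f', Y})"
      by (rule fillable_tiled[rotated])
    then show ?thesis by (simp add: insert_commute)
  qed
  have mf: "real m *\<^sub>R f' = (c\<^sup>2 - h) *\<^sub>R F"
    unfolding f'_def h_def w[symmetric] by simp
  have ng: "real n *\<^sub>R g' = c *\<^sub>R E1 - E2"
    using pos by (simp add: g'_def)
  have "g - h = 1"
    using pos by (simp add: g_def h_def divide_simps) (simp add: algebra_simps power2_eq_square)
  then have gh: "1 + c\<^sup>2 = g + (c\<^sup>2 - h)" "g = h + 1"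
    by simp_all
  have "vB + g *\<^sub>R F + (c\<^sup>2 - h) *\<^sub>R F = vD"
    unfolding vD_F gh(1) by (simp add: algebra_simps)
  moreover have "vB + g *\<^sub>R F + (c *\<^sub>R E1 - E2) = vB + - E1 + h *\<^sub>R F"
    unfolding gh(2) by (simp add: F_def algebra_simps)
  moreover from this have "vB + g *\<^sub>R F + (c\<^sup>2 - h) *\<^sub>R F + (c *\<^sub>R E1 - E2) = vO"
    unfolding vO_F by (simp add: algebra_simps)
  ultimately show ?thesis
    using tiled_parallelogram[OF cr mn(1,2) up down, of "vB + g *\<^sub>R F"] unfolding mf ng by (simp only:)
qed

text \<open>A copy of AMOP shrunk by the factor t c^2 has legs as long as \<open>vB vM\<close>.
  Placed at \<open>vB\<close>, it leaves the parallelogram, and just one of its three tiles reaches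
  \<open>vB\<close>.\<close>

lemma tiled_BMOD: "tiled_at Rs vB 1 (convex hull {vB, vD, vM, vO})"
proof -
  \<comment> \<open>In units of \<open>F\<close>, \<open>g\<close> and \<open>h\<close> are the
    bottom and the top of the shrunken copy, and \<open>k\<close> marks the point of the bottom
    where its three tiles meet.\<close>
  define k g h where "k = 1 / c" "g = (c + 1 + c\<^sup>2) / ((c + 1) * c)" "h = 1 / ((c + 1) * c)"
  note kgh = this
  have pos: "0 < c" using c_gt_1 by simp
  have diffs: "k - g = - c / (c + 1)" "h - g = - 1" "h - k = - 1 / (c + 1)"
    using pos by (simp_all add: kgh divide_simps) (simp_all add: algebra_simps power2_eq_square)
  have ord: "0 < k" "0 < h" "k \<le> g" "g \<le> 1 + c\<^sup>2" "h \<le> c\<^sup>2"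
  proof -
    show "0 < k" "0 < h" using pos by (simp_all add: kgh)
    have "0 \<le> c / (c + 1)" using pos by simp
    then show "k \<le> g" using diffs(1) by simp
    have "h \<le> 1" "1 \<le> c\<^sup>2" using c_gt_1 by (simp_all add: kgh divide_le_eq_1 less_1_mult less_imp_le)
    then show "h \<le> c\<^sup>2" "g \<le> 1 + c\<^sup>2" using diffs(2) by simp_all
  qed
  have "tiled Rs (convex hull {vB + k *\<^sub>R F, vB + g *\<^sub>R F, vB + - E1 + h *\<^sub>R F})"
  proof -
    have "tri (s * (1 / t)) (vB + g *\<^sub>R F) (vB + k *\<^sub>R F) (vB + - E1 + h *\<^sub>R F)"
    proof (rule tri_if_coordinates[OF E, where x = c and y = "- c / (c + 1)" and x' = c and y' = "- 1"])
      have "vB + k *\<^sub>R F - (vB + g *\<^sub>R F) = (k - g) *\<^sub>R F"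
        "vB + - E1 + h *\<^sub>R F - (vB + g *\<^sub>R F) = - E1 + (h - g) *\<^sub>R F"
        by (simp_all add: algebra_simps)
      moreover have "(- c / (c + 1)) *\<^sub>R F = c *\<^sub>R E1 + (- c / (c + 1)) *\<^sub>R E2"
        using pos by (simp add: F_def scaleR_diff_right)
      ultimately show "vB + k *\<^sub>R F - (vB + g *\<^sub>R F) = c *\<^sub>R E1 + (- c / (c + 1)) *\<^sub>R E2"
        "vB + - E1 + h *\<^sub>R F - (vB + g *\<^sub>R F) = c *\<^sub>R E1 + (- 1) *\<^sub>R E2"
        unfolding diffs by (simp_all add: F_def algebra_simps)
    qed (use pos in \<open>simp_all add: power_divide t_squared divide_simps\<close>, (simp_all add: algebra_simps power2_eq_square)?)
    then show ?thesis
      using fillable_tiled[OF fill, of "1 / t"] by (simp add: insert_commute)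
  qed
  then have "tiled Rs (convex hull {vB + k *\<^sub>R F, vD, vB + - E1 + h *\<^sub>R F, vO})"
    using tiled_trapezoid_Un[OF cross2_F, of k g "1 + c\<^sup>2" h h "c\<^sup>2" Rs vB] ord
      tiled_GHOD unfolding kgh(2,3)[symmetric] vD_F vO_F by (simp add: insert_commute)
  moreover have "tiled Rs (convex hull {vB + k *\<^sub>R F, vM, vB + - E1 + h *\<^sub>R F})"
  proof -
    have "tri (s * (1 / (t * c))) (vB + k *\<^sub>R F) (vB + - E1 + h *\<^sub>R F) vM"
    proof (rule tri_if_coordinates[OF E, where x = 0 and y = "- 1 / (c + 1)" and x' = "1 / c" and y' = "- 1 / c"])
      have "vB + - E1 + h *\<^sub>R F - (vB + k *\<^sub>R F) = - E1 + (h - k) *\<^sub>R F"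
        "vM - (vB + k *\<^sub>R F) = - E1 - k *\<^sub>R F"
        unfolding vM_F by (simp_all add: algebra_simps)
      moreover have "- E1 + (- 1 / (c + 1)) *\<^sub>R F = (- 1 / (c + 1)) *\<^sub>R E2"
        using pos by (simp add: scale_F)
      moreover have "- E1 - k *\<^sub>R F = (k * (c + 1) - 1) *\<^sub>R E1 + (- k) *\<^sub>R E2"
        unfolding scale_F by (simp add: algebra_simps)
      moreover have "k * (c + 1) - 1 = 1 / c" "- k = - 1 / c"
        using pos by (simp_all add: kgh(1) field_simps)
      ultimately show "vB + - E1 + h *\<^sub>R F - (vB + k *\<^sub>R F) = 0 *\<^sub>R E1 + (- 1 / (c + 1)) *\<^sub>R E2"
        "vM - (vB + k *\<^sub>R F) = (1 / c) *\<^sub>R E1 + (- 1 / c) *\<^sub>R E2"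
        unfolding diffs by simp_all
    qed (use pos in \<open>simp_all add: power_divide power_mult_distrib t_squared divide_simps\<close>, (simp_all add: algebra_simps power2_eq_square)?)
    moreover have "fillable Rs (s * (1 / (t * c)))" by (rule fill) simp
    ultimately have "tiled Rs (convex hull {vB + k *\<^sub>R F, vB + - E1 + h *\<^sub>R F, vM})"
      by (rule fillable_tiled[rotated])
    then show ?thesis by (simp add: insert_commute)
  qed
  ultimately have rest: "tiled Rs (convex hull {vB + k *\<^sub>R F, vD, vM, vO})"
    using tiled_trapezoid_Un[OF cross2_F, of k k "1 + c\<^sup>2" 0 h "c\<^sup>2" Rs vB] ord
    unfolding vD_F vO_F vM_F by (simp add: insert_commute)
  have "tiled_at Rs vB 1 (convex hull {vB, vM, vB + k *\<^sub>R F})"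
  proof (rule fillable_tiled_at[OF fill])
    show "tri (s * (1 / c)) vB vM (vB + k *\<^sub>R F)"
    proof (rule tri_if_coordinates[OF E, where x = "- 1" and y = 0 and x' = "- (k * (c + 1))" and y' = k])
      show "vM - vB = (- 1) *\<^sub>R E1 + 0 *\<^sub>R E2"
        unfolding vM_F by simp
      show "vB + k *\<^sub>R F - vB = (- (k * (c + 1))) *\<^sub>R E1 + k *\<^sub>R E2"
        unfolding scale_F by simp
    qed (use pos in \<open>simp_all add: kgh(1) power_divide divide_simps\<close>, (simp_all add: algebra_simps power2_eq_square)?)
  qed simp_all
  moreover have "vB \<notin> convex hull {vB + k *\<^sub>R F, vD, vM, vO}"
  proof -
    have "vB + 0 *\<^sub>R F + 0 *\<^sub>R - E1 \<notin> convex hull {vB + k *\<^sub>R F, vD, vM, vO}"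
      unfolding vD_F vO_F vM_F
      by (rule not_in_convex_hull[OF cross2_F, where p = 1 and q = k and b = k
            and C = "{(k, 0), (1 + c\<^sup>2, 0), (0, 1), (c\<^sup>2, 1)}"]) (use ord in auto)
    then show ?thesis by simp
  qed
  moreover have "negligible (convex hull {vB, vB + k *\<^sub>R F, vM} \<inter> convex hull {vB + k *\<^sub>R F, vD, vM, vO})"
    using negligible_trapezoid_split[OF cross2_F, of 0 k "1 + c\<^sup>2" 0 0 "c\<^sup>2" vB] ord
    unfolding vD_F vO_F vM_F by simp
  moreover have "convex hull {vB, vD, vM, vO}
      = convex hull {vB, vB + k *\<^sub>R F, vM} \<union> convex hull {vB + k *\<^sub>R F, vD, vM, vO}"
    using convex_hull_trapezoid_split[of 0 k "1 + c\<^sup>2" 0 0 "c\<^sup>2" vB F "- E1"] ord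
    unfolding vD_F vO_F vM_F by simp
  ultimately show ?thesis
    using tiled_at_Un_left[OF _ rest] by (simp add: insert_commute)
qed

section \<open>Assembling the pieces\<close>

lemma triangle_decomposition:
  "convex hull {vA, vB, vD} = convex hull {vA, vM, vP, vO} \<union> convex hull {vP, vO, vD} \<union> convex hull {vB, vD, vM, vO}"
    (is "?T = ?S1 \<union> ?S2 \<union> ?S3")
proof
  have pos: "0 < c" "0 < c\<^sup>2" "0 < c ^ 3" using c_gt_1 by simp_all
  \<comment> \<open>\<open>vK\<close> is where the line \<open>vD vO\<close> meets
    \<open>vA vB\<close>. With it every cut is a cevian of a triangle, and the small triangles are
    regrouped into the three pieces.\<close>
  define vK where "vK = pt (c + c ^ 3) 0"
  have e: "(c + 1) * (1 + c\<^sup>2) = c + c\<^sup>2 + c ^ 3 + 1"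
    by (simp add: algebra_simps power2_eq_square power3_eq_cube)
  have K1: "vK \<in> closed_segment vA vM" and M: "vM \<in> closed_segment vA vB"
    and P: "vP \<in> closed_segment vA vD" and K: "vK \<in> closed_segment vA vB" and M': "vM \<in> closed_segment vK vB"
    unfolding vK_def vA_def vM_def vB_def vP_def vD_def e
    using pos by (simp_all add: pt_axis_segment)
  have O: "vO \<in> closed_segment vK vD"
  proof -
    have "0 < 1 + c\<^sup>2" by (intro add_pos_nonneg) simp_all
    then have w: "0 < 1 + c\<^sup>2" "c\<^sup>2 / (1 + c\<^sup>2) \<le> 1"
      by (simp_all only: divide_le_eq_1_pos)
    then have "c = (1 - c\<^sup>2 / (1 + c\<^sup>2)) * (c + c ^ 3)"
      by (simp add: field_simps power2_eq_square power3_eq_cube)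
    then show ?thesis
      unfolding vO_def vK_def vD_def using w
      by (intro pt_closed_segment[of "c\<^sup>2 / (1 + c\<^sup>2)"]) simp_all
  qed
  have sub: "X \<in> convex hull S" if "X \<in> closed_segment a b" "a \<in> convex hull S" "b \<in> convex hull S" for X a b :: point and S
    using closed_segment_subset[OF that(2,3)] that(1) by auto
  have K1': "vK \<in> ?S1"
    using K1 by (rule sub) (simp_all add: hull_inc)
  have "?T = convex hull {vD, vA, vK} \<union> convex hull {vD, vK, vB}"
    using convex_hull_cevian[OF K, of vD] by (simp add: insert_commute)
  also have "convex hull {vD, vA, vK} = convex hull {vA, vK, vO} \<union> convex hull {vA, vO, vD}"
    using convex_hull_cevian[OF O, of vA] by (simp add: insert_commute)
  also have "convex hull {vD, vK, vB} = convex hull {vB, vK, vO} \<union> convex hull {vB, vO, vD}"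
    using convex_hull_cevian[OF O, of vB] by (simp add: insert_commute)
  also have "convex hull {vA, vO, vD} = convex hull {vO, vA, vP} \<union> convex hull {vO, vP, vD}"
    using convex_hull_cevian[OF P, of vO] by (simp add: insert_commute)
  also have "convex hull {vB, vK, vO} = convex hull {vO, vK, vM} \<union> convex hull {vO, vM, vB}"
    using convex_hull_cevian[OF M', of vO] by (simp add: insert_commute)
  finally have T: "?T = convex hull {vA, vK, vO} \<union> (convex hull {vO, vA, vP} \<union> convex hull {vO, vP, vD})
      \<union> (convex hull {vO, vK, vM} \<union> convex hull {vO, vM, vB} \<union> convex hull {vB, vO, vD})" .
  have S1: "convex hull {vA, vK, vO} \<subseteq> ?S1" "convex hull {vO, vK, vM} \<subseteq> ?S1" "convex hull {vO, vA, vP} \<subseteq> ?S1"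
    by (intro hull_minimal; simp add: hull_inc K1')+
  have S3: "convex hull {vB, vO, vD} \<subseteq> ?S3" "convex hull {vO, vM, vB} \<subseteq> ?S3"
    by (intro hull_mono; simp)+
  have S2: "convex hull {vO, vP, vD} \<subseteq> ?S2" by (simp add: insert_commute)
  show "?T \<subseteq> ?S1 \<union> ?S2 \<union> ?S3"
    unfolding T using S1 S2 S3 by (intro Un_least) (simp_all only: le_supI1 le_supI2)
  have "vM \<in> ?T" "vP \<in> ?T" "vK \<in> ?T"
    by (rule sub[OF M] sub[OF P] sub[OF K]; simp add: hull_inc)+
  moreover from this have "vO \<in> ?T"
    by (intro sub[OF O]) (simp_all add: hull_inc)
  ultimately show "?S1 \<union> ?S2 \<union> ?S3 \<subseteq> ?T"
    by (intro Un_least hull_minimal) (simp_all add: hull_inc)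
qed

lemma tiled_split_triangle: "tiled_at Rs vB 2 (convex hull {vA, vB, vC})"
proof -
  have pos: "0 < c" "0 < c\<^sup>2" "0 < c ^ 3" using c_gt_1 by simp_all
  have e: "(c + 1) * (1 + c\<^sup>2) = c + c\<^sup>2 + c ^ 3 + 1" by (simp add: algebra_simps power2_eq_square power3_eq_cube)
  have D: "vD \<in> closed_segment vA vC"
    unfolding vA_def vD_def vC_def
    by (rule pt_axis_segment) (use pos in \<open>simp_all add: pos_le_divide_eq algebra_simps\<close>)
  \<comment> \<open>The separating lines in \<open>n1\<close> to \<open>n4\<close> are
    \<open>vP vO\<close>, \<open>vM vO\<close>, \<open>vD vO\<close> and \<open>vB vD\<close>;
    \<open>b1\<close> uses \<open>vM vO\<close> again, and \<open>b2\<close> the parallel to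
    \<open>vA vC\<close> through \<open>vO\<close>.\<close>
  have n1: "negligible (convex hull {vA, vM, vP, vO} \<inter> convex hull {vP, vO, vD})"
    using negligible_pt[where p = 0 and q = 1 and b = "c\<^sup>2" and C = "{(0, 0), (c + c\<^sup>2 + c ^ 3, 0), (0, c\<^sup>2), (c, c\<^sup>2)}"
        and C' = "{(0, c\<^sup>2), (c, c\<^sup>2), (0, 1 + c\<^sup>2)}"]
    unfolding vA_def vM_def vP_def vO_def vD_def by simp
  have n2: "negligible (convex hull {vA, vM, vP, vO} \<inter> convex hull {vB, vD, vM, vO})"
    using negligible_pt[where p = 1 and q = "c + 1" and b = "c + c\<^sup>2 + c ^ 3" and C = "{(0, 0), (c + c\<^sup>2 + c ^ 3, 0), (0, c\<^sup>2), (c, c\<^sup>2)}"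
        and C' = "{((c + 1) * (1 + c\<^sup>2), 0), (0, 1 + c\<^sup>2), (c + c\<^sup>2 + c ^ 3, 0), (c, c\<^sup>2)}"] pos
    unfolding vA_def vM_def vP_def vO_def vD_def vB_def e by (simp add: algebra_simps power2_eq_square power3_eq_cube)
  have n3: "negligible (convex hull {vP, vO, vD} \<inter> convex hull {vB, vD, vM, vO})"
    using negligible_pt[where p = 1 and q = c and b = "c + c ^ 3"
        and C = "{(0, c\<^sup>2), (c, c\<^sup>2), (0, 1 + c\<^sup>2)}"
        and C' = "{((c + 1) * (1 + c\<^sup>2), 0), (0, 1 + c\<^sup>2), (c + c\<^sup>2 + c ^ 3, 0), (c, c\<^sup>2)}"] pos
    unfolding vM_def vP_def vO_def vD_def vB_def e by (simp add: algebra_simps power2_eq_square power3_eq_cube)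
  have n4: "negligible (convex hull {vA, vB, vD} \<inter> convex hull {vB, vD, vC})"
    using negligible_pt[where p = 1 and q = "c + 1" and b = "(c + 1) * (1 + c\<^sup>2)"
        and C = "{(0, 0), ((c + 1) * (1 + c\<^sup>2), 0), (0, 1 + c\<^sup>2)}"
        and C' = "{((c + 1) * (1 + c\<^sup>2), 0), (0, 1 + c\<^sup>2), (0, (c + 1) * (1 + c\<^sup>2) / c)}"] pos
    unfolding vA_def vC_def vD_def vB_def by (simp add: pos_le_divide_eq)
  have b1: "vB \<notin> convex hull {vA, vM, vP, vO}"
    using pt_notin[where p = "- 1" and q = "- (c + 1)" and b = "- (c + c\<^sup>2 + c ^ 3)" and ?x0.0 = "(c + 1) * (1 + c\<^sup>2)"
        and ?y0.0 = 0 and C = "{(0, 0), (c + c\<^sup>2 + c ^ 3, 0), (0, c\<^sup>2), (c, c\<^sup>2)}"] pos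
    unfolding vA_def vM_def vP_def vO_def vB_def e by (simp add: algebra_simps power2_eq_square power3_eq_cube)
  have b2: "vB \<notin> convex hull {vP, vO, vD}"
    using pt_notin[where p = "- 1" and q = 0 and b = "- c" and ?x0.0 = "(c + 1) * (1 + c\<^sup>2)"
        and ?y0.0 = 0 and C = "{(0, c\<^sup>2), (c, c\<^sup>2), (0, 1 + c\<^sup>2)}"] pos
    unfolding vP_def vO_def vD_def vB_def e by simp
  have "tiled Rs (convex hull {vA, vM, vP, vO} \<union> convex hull {vP, vO, vD})"
    using tiled_Un[OF tiled_AMOP tiled_POD n1] .
  then have "tiled_at Rs vB 1 (convex hull {vB, vD, vM, vO} \<union> (convex hull {vA, vM, vP, vO} \<union> convex hull {vP, vO, vD}))"
    by (rule tiled_at_Un_left[OF tiled_BMOD])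
      (use n2 n3 b1 b2 in \<open>simp_all add: Int_Un_distrib Int_commute\<close>)
  then have "tiled_at Rs vB 1 (convex hull {vA, vB, vD})"
    unfolding triangle_decomposition by (simp add: Un_ac)
  then have "tiled_at Rs vB (1 + 1) (convex hull {vA, vB, vD} \<union> convex hull {vB, vD, vC})"
    by (rule tiled_at_Un[OF _ tiled_BCD n4])
  moreover have "convex hull {vA, vB, vC} = convex hull {vA, vB, vD} \<union> convex hull {vB, vD, vC}"
    using convex_hull_cevian[OF D, of vB] by (simp add: insert_commute)
  ultimately show ?thesis by (simp only: one_add_one)
qed

end
end

subsection \<open>From side lengths to the theorem\<close>

text \<open>Nonempty open sets are not negligible, so interiors are disjoint. With a single
  admissible ratio the similarities between tiles are isometries.\<close>

lemma (in tile_shape) splitting_if_tiled_at: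
  assumes T: "tri \<sigma> P Q R" "0 < \<sigma>" and v: "v \<in> {P, Q, R}"
    and tiled: "tiled_at Rs v k (convex hull {P, Q, R})" and "2 \<le> k"
  shows "\<exists>r \<D>. splitting_gentiling k r (convex hull {P, Q, R}) \<D>"
    and "Rs = {\<rho>} \<Longrightarrow> \<exists>r \<D>. splitting_reptiling k r (convex hull {P, Q, R}) \<D>"
proof -
  let ?T = "convex hull {P, Q, R}"
  obtain \<D> where D: "finite \<D>" "\<Union>\<D> = ?T" "\<forall>D\<in>\<D>. tile Rs D"
    "pairwise (\<lambda>D D'. negligible (D \<inter> D')) \<D>" "card {D \<in> \<D>. v \<in> D} = k"
    using tiled unfolding tiled_at_def by (elim exE conjE) (rule that)
  have "card {D \<in> \<D>. v \<in> D} \<le> card \<D>"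
    using D(1) by (intro card_mono) auto
  then have "2 \<le> card \<D>"
    using D(5) \<open>2 \<le> k\<close> by simp
  moreover have "2 simplex D \<and> similar D ?T" if DD: "D \<in> \<D>" for D
  proof -
    obtain \<rho> P' Q' R' where "0 < \<rho>" "tri \<rho> P' Q' R'" and D': "D = convex hull {P', Q', R'}"
      using bspec[OF D(3) DD] by (rule tileE)
    then show ?thesis
      using tri_simplex(1) tri_similar[OF _ T(1) _ T(2)] unfolding similar_def D' by blast
  qed
  moreover have "interior D \<inter> interior D' = {}" if "D \<in> \<D>" "D' \<in> \<D>" "D \<noteq> D'" for D D'
  proof -
    have "negligible (D \<inter> D')"
      using pairwiseD[OF D(4) that] .
    then have "negligible (interior D \<inter> interior D')"
      by (rule negligible_subset) (use interior_subset in blast)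
    then show ?thesis
      using open_not_negligible by (metis open_Int open_interior)
  qed
  ultimately have gentiling: "gentiling (card \<D>) ?T \<D>"
    unfolding gentiling_def using D(1,2) tri_simplex(1)[OF T] by blast
  have "v extreme_point_of ?T"
  proof -
    have "\<not> affine_dependent {P, Q, R}"
      using cross2_imp_not_collinear[OF tri_cross2[OF T]] unfolding collinear_3_eq_affine_dependent by blast
    then show ?thesis
      using extreme_point_of_convex_hull_affine_independent v by blast
  qed
  then have splits: "splits_vertex k ?T \<D>"
    unfolding splits_vertex_def using D(5) by blast
  show "\<exists>r \<D>. splitting_gentiling k r ?T \<D>"
    unfolding splitting_gentiling_def using gentiling splits \<open>2 \<le> k\<close> by blast
  show "\<exists>r \<D>. splitting_reptiling k r ?T \<D>" if "Rs = {\<rho>}"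
  proof -
    have "congruent_sets D D'" if DD': "D \<in> \<D>" "D' \<in> \<D>" for D D'
    proof -
      obtain \<rho>1 P1 Q1 R1 where 1: "\<rho>1 \<in> Rs" "0 < \<rho>1" "tri \<rho>1 P1 Q1 R1" "D = convex hull {P1, Q1, R1}"
        using bspec[OF D(3) DD'(1)] by (rule tileE)
      obtain \<rho>2 P2 Q2 R2 where 2: "\<rho>2 \<in> Rs" "0 < \<rho>2" "tri \<rho>2 P2 Q2 R2" "D' = convex hull {P2, Q2, R2}"
        using bspec[OF D(3) DD'(2)] by (rule tileE)
      have "\<rho>1 = \<rho>2" using 1(1) 2(1) \<open>Rs = {\<rho>}\<close> by simp
      show ?thesis
        using tri_similar[OF 1(3) 2(3) 1(2) 2(2)] 2(2) \<open>\<rho>1 = \<rho>2\<close> unfolding congruent_sets_def 1(4) 2(4) by simp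
    qed
    then show ?thesis
      unfolding splitting_reptiling_def reptiling_def using gentiling splits \<open>2 \<le> k\<close> by blast
  qed
qed

text \<open>Once all ratios are multiples of 1 / N, one tile size subdivides every piece.\<close>

lemma common_denominator:
  fixes X :: "real set"
  assumes "finite X" "X \<subseteq> \<rat>" "\<forall>x\<in>X. 0 < x"
  shows "\<exists>N::nat. 0 < N \<and> (\<forall>x\<in>X. \<exists>k::nat. 0 < k \<and> x = k / N)"
  using assms
proof (induction X rule: finite_induct)
  case empty
  then show ?case by auto
next
  case (insert x X)
  then obtain N :: nat where N: "0 < N" "\<forall>x\<in>X. \<exists>k::nat. 0 < k \<and> x = k / N" by auto
  obtain a b :: nat where ab: "b \<noteq> 0" "\<bar>x\<bar> = a / b"
    using insert.prems by (auto elim: Rats_abs_nat_div_natE)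
  then have x: "x = a / b" "0 < a"
    using insert.prems by (auto intro: gr0I)
  have "\<exists>k::nat. 0 < k \<and> y = k / (N * b)" if "y \<in> insert x X" for y
  proof (cases "y = x")
    case True
    then show ?thesis
      using x N(1) ab(1) by (intro exI[of _ "a * N"]) simp
  next
    case False
    then have "y \<in> X" using that by simp
    then obtain k :: nat where "0 < k" "y = k / N" using N(2) by blast
    then show ?thesis
      using ab(1) by (intro exI[of _ "k * b"]) simp
  qed
  then show ?case
    using N(1) ab(1) by (intro exI[of _ "N * b"]) simp
qed

lemma inner_eq_cos_angle:
  assumes "a \<noteq> b" "d \<noteq> b"
  shows "(a - b) \<bullet> (d - b) = norm (a - b) * norm (d - b) * cos (angle a b d)"
proof -
  let ?x = "((a - b) \<bullet> (d - b)) / (norm (a - b) * norm (d - b))"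
  have pos: "0 < norm (a - b) * norm (d - b)"
    using assms by simp
  have "\<bar>?x\<bar> \<le> 1"
    using Cauchy_Schwarz_ineq2[of "a - b" "d - b"] pos by (simp add: abs_mult)
  then have "cos (angle a b d) = ?x"
    unfolding angle_def by (intro cos_arccos) linarith+
  then show ?thesis using pos by simp
qed

lemma sides_of_double_angle_triangle:
  assumes \<alpha>: "0 < \<alpha>" "\<alpha> < pi / 4"
    and ne: "A \<noteq> B" "A \<noteq> C" "B \<noteq> C"
    and angles: "angle B A C = \<alpha>" "angle A B C = 2 * \<alpha>"
  shows "norm (C - A) = 2 * cos \<alpha> * norm (C - B)"
    and "norm (B - A) = (4 * (cos \<alpha>)\<^sup>2 - 1) * norm (C - B)"
proof -
  define p q r where "p = norm (C - B)" "q = norm (C - A)" "r = norm (B - A)"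
  note pqr = this
  have pos: "0 < p" "0 < q" "0 < r" using ne by (simp_all add: pqr)
  have 1: "(B - A) \<bullet> (C - A) = r * q * cos \<alpha>"
    using inner_eq_cos_angle[of B A C] ne angles by (simp add: pqr)
  have 2: "(A - B) \<bullet> (C - B) = r * p * cos (2 * \<alpha>)"
    using inner_eq_cos_angle[of A B C] ne angles by (simp add: pqr norm_minus_commute)
  have "(B - A) \<bullet> (C - A) + (A - B) \<bullet> (C - B) = (B - A) \<bullet> (B - A)"
    by (simp add: inner_diff_left inner_diff_right)
  then have "r * (q * cos \<alpha> + p * cos (2 * \<alpha>)) = r * r"
    unfolding 1 2 by (simp add: pqr power2_norm_eq_inner[symmetric] power2_eq_square algebra_simps)
  then have r: "r = q * cos \<alpha> + p * cos (2 * \<alpha>)"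
    using pos by simp
  have "(C - B) \<bullet> (C - B) = (C - A) \<bullet> (C - A) + (B - A) \<bullet> (B - A) - 2 * ((B - A) \<bullet> (C - A))"
    by (simp add: inner_diff_left inner_diff_right inner_commute)
  then have p: "p\<^sup>2 = q\<^sup>2 + r\<^sup>2 - 2 * r * (q * cos \<alpha>)"
    unfolding 1 by (simp add: pqr power2_norm_eq_inner)
  have sin: "0 < sin \<alpha>" "0 < cos \<alpha>"
    using \<alpha> by (simp_all add: sin_gt_zero cos_gt_zero)
  \<comment> \<open>Both sides are the squared height over \<open>A B\<close>; the law of sines
    follows.\<close>
  have "(q * sin \<alpha>)\<^sup>2 = (p * sin (2 * \<alpha>))\<^sup>2"
    using p r unfolding power_mult_distrib sin_squared_eq by algebra
  moreover have "0 < sin (2 * \<alpha>)"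
    using sin by (simp add: sin_double)
  ultimately have "q * sin \<alpha> = p * sin (2 * \<alpha>)"
    using pos sin by (simp add: power2_eq_iff_nonneg)
  then have q: "q = 2 * cos \<alpha> * p"
    using sin(1) by (simp add: sin_double)
  then show "norm (C - A) = 2 * cos \<alpha> * norm (C - B)"
    unfolding pqr .
  have "r = (4 * (cos \<alpha>)\<^sup>2 - 1) * p"
    unfolding r q cos_double_cos by (simp add: algebra_simps power2_eq_square)
  then show "norm (B - A) = (4 * (cos \<alpha>)\<^sup>2 - 1) * norm (C - B)"
    unfolding pqr .
qed

theorem theorem7:
  fixes A B C :: point and T :: "point set" and \<alpha> :: real
  assumes "0 < \<alpha>" and "\<alpha> < pi / 4"
    and "\<not> collinear {A, B, C}"
    and "T = convex hull {A, B, C}"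
    and "angle B A C = \<alpha>"
    and "angle A B C = 2 * \<alpha>"
    and "angle A C B = pi - 3 * \<alpha>"
  shows "((cos \<alpha>)\<^sup>2 \<in> \<rat> \<longrightarrow> (\<exists>r \<D>. splitting_gentiling 2 r T \<D>)) \<and>
         (cos \<alpha> \<in> \<rat> \<longrightarrow> (\<exists>r \<D>. splitting_reptiling 2 r T \<D>))"
proof -
  define t where "t = 2 * cos \<alpha>"
  define p where "p = norm (C - B)"
  have ne: "A \<noteq> B" "A \<noteq> C" "B \<noteq> C"
    using assms(3) by (auto simp: insert_commute)
  have "0 < cos \<alpha>" "0 < cos (2 * \<alpha>)" "0 < sin \<alpha>"
    using assms(1,2) by (auto intro!: cos_gt_zero sin_gt_zero)
  moreover from \<open>0 < sin \<alpha>\<close> have "0 < (sin \<alpha>)\<^sup>2" by simp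
  \<comment> \<open>Here cos (2 \<alpha>) > 0, from \<alpha> < pi / 4, gives t^2 > 2, and sin
    \<alpha> > 0 gives t^2 < 4.\<close>
  ultimately interpret tile_shape t
    using sin_squared_eq[of \<alpha>] by unfold_locales (auto simp: t_def cos_double_cos power_mult_distrib)
  have c: "c = 4 * (cos \<alpha>)\<^sup>2 - 1" "0 < c"
    using c_gt_1 unfolding c_def by (simp_all add: t_def power_mult_distrib)
  have p: "0 < p" using ne by (simp add: p_def)
  have sides: "norm (C - A) = t * p" "norm (B - A) = c * p"
    using sides_of_double_angle_triangle[OF assms(1,2) ne assms(5,6)] unfolding c(1) by (simp_all add: t_def p_def)
  have inner: "(B - A) \<bullet> (B - A) = (p * c)\<^sup>2" "(C - A) \<bullet> (C - A) = (p * t)\<^sup>2"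
    unfolding power2_norm_eq_inner[symmetric] sides by (simp_all add: mult.commute)
  have inner': "(B - A) \<bullet> (C - A) = p\<^sup>2 * c * t\<^sup>2 / 2"
    using inner_eq_cos_angle[of B A C] ne assms(5) unfolding sides
    by (simp add: t_def power2_eq_square)
  have T: "tri p A B C"
    unfolding tri_def using inner inner' by simp
  define w where "w = (c + 1) * (1 + c\<^sup>2)"
  \<comment> \<open>\<open>A B\<close> has length \<open>c * p\<close> in \<open>T\<close> and
    \<open>w * s\<close> in the coordinates of the decomposition, which forces
    \<open>s\<close>.\<close>
  define s where "s = c * p / w"
  define E1 E2 where "E1 = (1 / w) *\<^sub>R (B - A)" "E2 = (c / w) *\<^sub>R (C - A)"
  note E_def = this
  have w: "0 < w" using c(2) by (simp add: w_def add_pos_nonneg)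
  have s: "0 < s" using w c p by (simp add: s_def)
  have E: "E1 \<bullet> E1 = s\<^sup>2" "E2 \<bullet> E2 = s\<^sup>2 * t\<^sup>2" "E1 \<bullet> E2 = s\<^sup>2 * t\<^sup>2 / 2"
    by (simp_all add: E_def inner inner' s_def power2_eq_square mult_ac)
  define X where "X n = {t * (1 + c\<^sup>2) / c, 1, t * c, c\<^sup>2, c, 1 / c, 1 / t, 1 / (t * c), 1 / (c * real n)}" for n :: nat
  have split: "tiled_at Rs B 2 (convex hull {A, B, C})"
    if mn: "0 < m" "0 < n" "c ^ 3 - 1 / t\<^sup>2 = real m / real n" and fill: "\<And>\<rho>. \<rho> \<in> X n \<Longrightarrow> fillable Rs (s * \<rho>)" for m n Rs
  proof -
    interpret split_triangle t A E1 E2 s m n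
      using s E mn by unfold_locales
    have "w *\<^sub>R E1 = B - A" "(w / c) *\<^sub>R E2 = C - A"
      using w c(2) by (simp_all add: E_def)
    then have "vA = A" "vB = B" "vC = C"
      unfolding vA_def vB_def vC_def pt_def w_def[symmetric] by simp_all
    then show ?thesis
      using tiled_split_triangle[OF fill] unfolding X_def by simp
  qed
  have mn: "\<exists>m n::nat. 0 < m \<and> 0 < n \<and> c ^ 3 - 1 / t\<^sup>2 = real m / real n" if "t\<^sup>2 \<in> \<rat>"
  proof -
    \<comment> \<open>c > 1 makes the quotient positive, so the parallelogram does not
      degenerate.\<close>
    have "1 / t\<^sup>2 < 1" "1 < c ^ 3"
      using t c_gt_1 by (simp_all add: divide_less_eq_1)
    then have "0 < c ^ 3 - 1 / t\<^sup>2" by simp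
    moreover have "c ^ 3 - 1 / t\<^sup>2 \<in> \<rat>"
      using that by (simp add: c_def)
    ultimately show ?thesis
      using common_denominator[of "{c ^ 3 - 1 / t\<^sup>2}"] by auto
  qed
  have "\<exists>r \<D>. splitting_gentiling 2 r T \<D>" if "(cos \<alpha>)\<^sup>2 \<in> \<rat>"
  proof -
    have "t\<^sup>2 \<in> \<rat>" using that by (simp add: t_def power_mult_distrib)
    then obtain m n :: nat where mn: "0 < m" "0 < n" "c ^ 3 - 1 / t\<^sup>2 = real m / real n"
      using mn by blast
    have "fillable {0<..} (s * \<rho>)" if "\<rho> \<in> X n" for \<rho>
      by (rule fillable_mem) (use that s t(1) c(2) mn(2) in \<open>auto simp: X_def intro!: mult_pos_pos divide_pos_pos add_pos_nonneg\<close>)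
    then have "tiled_at {0<..} B 2 (convex hull {A, B, C})"
      by (rule split[OF mn])
    then show ?thesis
      unfolding assms(4) by (rule splitting_if_tiled_at(1)[OF T p, rotated]) simp_all
  qed
  moreover have "\<exists>r \<D>. splitting_reptiling 2 r T \<D>" if "cos \<alpha> \<in> \<rat>"
  proof -
    have "t \<in> \<rat>" using that by (simp add: t_def)
    then have rat: "t \<in> \<rat>" "c \<in> \<rat>" by (simp_all add: c_def)
    then obtain m n :: nat where mn: "0 < m" "0 < n" "c ^ 3 - 1 / t\<^sup>2 = real m / real n"
      using mn by auto
    have "finite (X n)" "X n \<subseteq> \<rat>" "\<forall>x\<in>X n. 0 < x"
      using rat t(1) c(2) mn(2) unfolding X_def by (simp_all add: add_pos_nonneg)
    from common_denominator[OF this]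
    obtain N :: nat where N: "0 < N" "\<forall>x\<in>X n. \<exists>k::nat. 0 < k \<and> x = k / N"
      by (elim exE conjE) (rule that)
    have "fillable {s / N} (s * \<rho>)" if \<rho>: "\<rho> \<in> X n" for \<rho>
    proof -
      obtain k :: nat where "0 < k" "\<rho> = k / N" using bspec[OF N(2) \<rho>] by blast
      then show ?thesis
        using fillable_multiple[of "s / N" k] s N(1) by (simp add: mult.commute)
    qed
    then have "tiled_at {s / N} B 2 (convex hull {A, B, C})"
      by (rule split[OF mn])
    then show ?thesis
      unfolding assms(4) by (rule splitting_if_tiled_at(2)[OF T p, rotated]) simp_all
  qed
  ultimately show ?thesis by blast
qed

end
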